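(* Assume that $\mathcal U(\mathbf F)=\mathcal U_\Delta^\lambda(\mathbf F)$ is closed (in $\mathrm{Aut}(\Delta)$) and locally compact. Moreover, assume that for each $i\in I$, the group $F_i$ is compactly generated and has finitely many orbits on $X_i$. Then the universal group $\mathcal U(\mathbf F)$ is compactly generated.
   Context: Buildings. Let $I$ be a finite set and $M=(m_{ij})_{i,j\in I}$ a right-angled Coxeter matrix: $m_{ii}=1$ and $m_{ij}=m_{ji}\in\{2,\infty\}$ for $i\ne j$; let $W$ be the Coxeter group with generators $(s_i)_{i\in I}$. A (right-angled) building $\Delta$ of type $M$ is viewed as a chamber system: a set of chambers with an equivalence relation $\sim_i$ ($i$-adjacency) for each $i\in I$, all classes having at least two elements, and a map $\delta:\Delta\times\Delta\to W$ such that for each reduced word $s_{i_1}\cdots s_{i_k}$, $\delta(c,d)=s_{i_1}\cdots s_{i_k}$ iff there is a gallery $c=c_0\sim_{i_1}c_1\sim_{i_2}\cdots\sim_{i_k}c_k=d$ (consecutive chambers distinct) of type $(i_1,\dots,i_k)$. An $i$-panel is an equivalence class of $\sim_i$; $\mathrm{Res}_i(\Delta)$ is the set of $i$-panels. $\mathrm{Aut}(\Delta)$ is the group of bijections of the chamber set preserving each $\sim_i$. $\Delta$ is semiregular with parameters $(q_i)_{i\in I}$ if every $i$-panel has the same (possibly infinite) cardinality $q_i\ge 2$; for any choice of cardinals $q_i\geq 2$ such a building exists and is unique up to isomorphism. Universal groups. For each $i\in I$ let $X_i$ be a set (of $i$-colours) with $|X_i|\ge 2$ and $F_i\le\mathrm{Sym}(X_i)$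 an arbitrary permutation group (not necessarily transitive or of finite degree); write $\mathbf F=(F_i)_{i\in I}$. Let $\Delta$ be the semiregular right-angled building of type $M$ with $q_i=|X_i|$. A legal colouring is a map $\lambda=(\lambda_i)_{i\in I}:\Delta\to\prod_{i\in I}X_i$ such that for every $i$-panel $\mathcal P$, $\lambda_i|_{\mathcal P}:\mathcal P\to X_i$ is a bijection and $\lambda_j|_{\mathcal P}$ is constant for all $j\ne i$. Fix a legal colouring $\lambda$. The local action of $g\in\mathrm{Aut}(\Delta)$ at an $i$-panel $\mathcal P$ is $\sigma_\lambda(g,\mathcal P)=\lambda_i|_{g\mathcal P}\circ g|_{\mathcal P}\circ(\lambda_i|_{\mathcal P})^{-1}\in\mathrm{Sym}(X_i)$. The universal group is $\mathcal U_\Delta^\lambda(\mathbf F)=\{g\in\mathrm{Aut}(\Delta)\mid \sigma_\lambda(g,\mathcal P)\in F_i\text{ for all }i\in I,\ \mathcal P\in\mathrm{Res}_i(\Delta)\}$. Topology. Every permutation group $G\le\mathrm{Sym}(X)$ carries the permutation topology, in which the pointwise stabilisers of finite subsets of $X$ form a neighbourhood basis of the identity; this applies to $F_i\le\mathrm{Sym}(X_i)$ and to $\mathrm{Aut}(\Delta)$ and $\mathcal U_\Delta^\lambda(\mathbf F)$ acting on the set of chambers. A topological group is compactly generated if it is generated by a compact subset. *)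

theory Defs
  imports "HOL-Analysis.Analysis" "HOL-Algebra.Group_Action" "HOL-Algebra.Generated_Groups"
    "HOL-Library.Extended_Nat" "HOL-Library.Equipollence"
begin

section \<open>Coxeter groups\<close>

definition right_angled_coxeter_matrix :: "'i set \<Rightarrow> ('i \<Rightarrow> 'i \<Rightarrow> enat) \<Rightarrow> bool" where
  "right_angled_coxeter_matrix I M \<longleftrightarrow>
     (\<forall>i\<in>I. M i i = 1) \<and>
     (\<forall>i\<in>I. \<forall>j\<in>I. i \<noteq> j \<longrightarrow> M i j = M j i \<and> M i j \<in> {2, \<infinity>})"

text \<open>
  The Coxeter group is presented as a quotient of the free monoid of words over \<open>I\<close> by the
  congruence generated by \<open>(s\<^sub>i s\<^sub>j)\<^bsup>M i j\<^esup> = 1\<close> for finite \<open>M i j\<close>. Since \<open>M i i = 1\<close> makes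
  every generator an involution, this monoid presentation defines the same group as the usual
  group presentation.
\<close>

inductive coxeter_equiv :: "'i set \<Rightarrow> ('i \<Rightarrow> 'i \<Rightarrow> enat) \<Rightarrow> 'i list \<Rightarrow> 'i list \<Rightarrow> bool"
  for I M where
  refl: "w \<in> lists I \<Longrightarrow> coxeter_equiv I M w w"
| sym: "coxeter_equiv I M v w \<Longrightarrow> coxeter_equiv I M w v"
| trans: "coxeter_equiv I M u v \<Longrightarrow> coxeter_equiv I M v w \<Longrightarrow> coxeter_equiv I M u w"
| relation: "\<lbrakk>u \<in> lists I; v \<in> lists I; i \<in> I; j \<in> I; M i j = enat m\<rbrakk> \<Longrightarrow>
    coxeter_equiv I M (u @ concat (replicate m [i, j]) @ v) (u @ v)"

definition coxeter_class :: "'i set \<Rightarrow> ('i \<Rightarrow> 'i \<Rightarrow> enat) \<Rightarrow> 'i list \<Rightarrow> 'i list set" where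
  "coxeter_class I M w = {v. coxeter_equiv I M w v}"

definition coxeter_group :: "'i set \<Rightarrow> ('i \<Rightarrow> 'i \<Rightarrow> enat) \<Rightarrow> 'i list set monoid" where
  "coxeter_group I M =
     \<lparr>carrier = coxeter_class I M ` lists I,
      mult = (\<lambda>A B. {w. \<exists>u\<in>A. \<exists>v\<in>B. coxeter_equiv I M (u @ v) w}),
      one = coxeter_class I M []\<rparr>"

definition coxeter_gen :: "'i set \<Rightarrow> ('i \<Rightarrow> 'i \<Rightarrow> enat) \<Rightarrow> 'i \<Rightarrow> 'i list set" where
  "coxeter_gen I M i = coxeter_class I M [i]"

definition coxeter_word :: "'i set \<Rightarrow> ('i \<Rightarrow> 'i \<Rightarrow> enat) \<Rightarrow> 'i list \<Rightarrow> 'i list set" where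
  "coxeter_word I M w =
     foldr (\<lambda>i a. coxeter_gen I M i \<otimes>\<^bsub>coxeter_group I M\<^esub> a) w \<one>\<^bsub>coxeter_group I M\<^esub>"

definition coxeter_reduced :: "'i set \<Rightarrow> ('i \<Rightarrow> 'i \<Rightarrow> enat) \<Rightarrow> 'i list \<Rightarrow> bool" where
  "coxeter_reduced I M w \<longleftrightarrow> w \<in> lists I \<and>
     (\<forall>v\<in>lists I. coxeter_word I M v = coxeter_word I M w \<longrightarrow> length w \<le> length v)"

lemma coxeter_equiv_lists:
  assumes "coxeter_equiv I M u v"
  shows "u \<in> lists I \<and> v \<in> lists I"
  using assms
proof (induction rule: coxeter_equiv.induct)
  case (relation u v i j m)
  have "concat (replicate m [i, j]) \<in> lists I"
    using relation(3,4) by (auto split: if_splits)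
  with relation show ?case by auto
qed auto

lemma coxeter_equiv_context:
  assumes "coxeter_equiv I M u v" "a \<in> lists I" "b \<in> lists I"
  shows "coxeter_equiv I M (a @ u @ b) (a @ v @ b)"
  using assms(1)
proof (induction rule: coxeter_equiv.induct)
  case (refl w)
  then show ?case using assms by (intro coxeter_equiv.refl) auto
next
  case (sym v w)
  show ?case by (rule coxeter_equiv.sym[OF sym.IH])
next
  case (trans u v w)
  show ?case by (rule coxeter_equiv.trans[OF trans.IH])
next
  case (relation u v i j m)
  then show ?case
    using coxeter_equiv.relation[of "a @ u" I "v @ b" i j M m] assms by auto
qed

lemma coxeter_class_eq_iff:
  assumes "u \<in> lists I"
  shows "coxeter_class I M u = coxeter_class I M v \<longleftrightarrow> coxeter_equiv I M u v"
proof
  assume "coxeter_class I M u = coxeter_class I M v"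
  moreover have "u \<in> coxeter_class I M u"
    using coxeter_equiv.refl[OF assms] by (simp add: coxeter_class_def)
  ultimately have "coxeter_equiv I M v u" by (simp add: coxeter_class_def)
  then show "coxeter_equiv I M u v" by (rule coxeter_equiv.sym)
next
  assume uv: "coxeter_equiv I M u v"
  have "coxeter_equiv I M u w \<longleftrightarrow> coxeter_equiv I M v w" for w
    using coxeter_equiv.trans[OF uv, of w] coxeter_equiv.trans[OF coxeter_equiv.sym[OF uv], of w]
    by blast
  then show "coxeter_class I M u = coxeter_class I M v" by (simp add: coxeter_class_def)
qed

lemma coxeter_mult_class:
  assumes "u \<in> lists I" "v \<in> lists I"
  shows "coxeter_class I M u \<otimes>\<^bsub>coxeter_group I M\<^esub> coxeter_class I M v = coxeter_class I M (u @ v)"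
proof -
  have "coxeter_equiv I M (u @ v) w"
    if "coxeter_equiv I M u u'" "coxeter_equiv I M v v'" "coxeter_equiv I M (u' @ v') w" for u' v' w
  proof -
    have "coxeter_equiv I M (u @ v) (u' @ v)"
      using coxeter_equiv_context[OF that(1), of "[]" v] assms by auto
    moreover have "coxeter_equiv I M (u' @ v) (u' @ v')"
      using coxeter_equiv_context[OF that(2), of u' "[]"] coxeter_equiv_lists[OF that(1)] by auto
    ultimately show ?thesis
      by (rule coxeter_equiv.trans[OF coxeter_equiv.trans[OF _ _] that(3)])
  qed
  moreover have "coxeter_equiv I M u u" "coxeter_equiv I M v v"
    using assms by (simp_all add: coxeter_equiv.refl)
  ultimately show ?thesis
    unfolding coxeter_group_def coxeter_class_def by auto
qed

lemma coxeter_word_eq_class: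
  assumes "w \<in> lists I"
  shows "coxeter_word I M w = coxeter_class I M w"
  using assms
proof (induction w)
  case Nil
  then show ?case by (simp add: coxeter_word_def coxeter_group_def)
next
  case (Cons i w)
  then have "coxeter_word I M (i # w) =
      coxeter_class I M [i] \<otimes>\<^bsub>coxeter_group I M\<^esub> coxeter_class I M w"
    by (auto simp: coxeter_word_def coxeter_gen_def)
  then show ?case using Cons by (simp add: coxeter_mult_class)
qed

lemma group_coxeter_group:
  assumes "\<And>i. i \<in> I \<Longrightarrow> M i i = 1"
  shows "group (coxeter_group I M)"
proof (rule groupI)
  let ?W = "coxeter_group I M"
  have carrier: "carrier ?W = coxeter_class I M ` lists I"
    and one: "\<one>\<^bsub>?W\<^esub> = coxeter_class I M []"
    by (simp_all add: coxeter_group_def)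
  show "x \<otimes>\<^bsub>?W\<^esub> y \<in> carrier ?W" if xy: "x \<in> carrier ?W" "y \<in> carrier ?W" for x y
  proof -
    obtain u v where "u \<in> lists I" "v \<in> lists I"
      "x = coxeter_class I M u" "y = coxeter_class I M v"
      using xy unfolding carrier by (elim imageE)
    moreover from this have "u @ v \<in> lists I" by auto
    ultimately show ?thesis by (simp add: carrier coxeter_mult_class)
  qed
  show "\<one>\<^bsub>?W\<^esub> \<in> carrier ?W" by (simp add: carrier one)
  show "x \<otimes>\<^bsub>?W\<^esub> y \<otimes>\<^bsub>?W\<^esub> z = x \<otimes>\<^bsub>?W\<^esub> (y \<otimes>\<^bsub>?W\<^esub> z)"
    if xyz: "x \<in> carrier ?W" "y \<in> carrier ?W" "z \<in> carrier ?W" for x y z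
  proof -
    obtain u v w where "u \<in> lists I" "v \<in> lists I" "w \<in> lists I"
      "x = coxeter_class I M u" "y = coxeter_class I M v" "z = coxeter_class I M w"
      using xyz unfolding carrier by (elim imageE)
    moreover from this have "u @ v \<in> lists I" "v @ w \<in> lists I" by auto
    ultimately show ?thesis by (simp only: coxeter_mult_class append_assoc)
  qed
  show "\<one>\<^bsub>?W\<^esub> \<otimes>\<^bsub>?W\<^esub> x = x" if x: "x \<in> carrier ?W" for x
  proof -
    obtain w where "w \<in> lists I" "x = coxeter_class I M w"
      using x unfolding carrier by (elim imageE)
    then show ?thesis using coxeter_mult_class[of "[]" I w M] by (simp add: one)
  qed
  show "\<exists>y\<in>carrier ?W. y \<otimes>\<^bsub>?W\<^esub> x = \<one>\<^bsub>?W\<^esub>" if x: "x \<in> carrier ?W" for x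
  proof -
    obtain w where w: "w \<in> lists I" "x = coxeter_class I M w"
      using x unfolding carrier by (elim imageE)
    have rev_w: "rev w \<in> lists I" using w(1) by auto
    have "coxeter_equiv I M (rev w @ w) []" using w(1)
    proof (induction w)
      case Nil
      then show ?case by (simp add: coxeter_equiv.refl)
    next
      case (Cons i w)
      then have "coxeter_equiv I M (rev w @ concat (replicate 1 [i, i]) @ w) (rev w @ w)"
        using assms[of i] by (intro coxeter_equiv.relation) (auto simp: one_enat_def)
      moreover have "coxeter_equiv I M (rev w @ w) []" using Cons by auto
      ultimately have "coxeter_equiv I M (rev w @ concat (replicate 1 [i, i]) @ w) []"
        by (rule coxeter_equiv.trans)
      then show ?case by simp
    qed
    then have "coxeter_class I M (rev w @ w) = coxeter_class I M []"
      using w(1) by (subst coxeter_class_eq_iff) auto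
    then show ?thesis
      using w rev_w by (intro bexI[of _ "coxeter_class I M (rev w)"])
        (auto simp: carrier one coxeter_mult_class)
  qed
qed

section \<open>Buildings as chamber systems\<close>

definition panels :: "'c set \<Rightarrow> ('i \<Rightarrow> ('c \<times> 'c) set) \<Rightarrow> 'i \<Rightarrow> 'c set set" where
  "panels C R i = C // R i"

definition gallery ::
  "'c set \<Rightarrow> ('i \<Rightarrow> ('c \<times> 'c) set) \<Rightarrow> 'i list \<Rightarrow> 'c \<Rightarrow> 'c \<Rightarrow> 'c list \<Rightarrow> bool" where
  "gallery C R w c d cs \<longleftrightarrow>
     length cs = Suc (length w) \<and> set cs \<subseteq> C \<and> cs ! 0 = c \<and> cs ! length w = d \<and>
     (\<forall>k<length w. (cs ! k, cs ! Suc k) \<in> R (w ! k) \<and> cs ! k \<noteq> cs ! Suc k)"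

definition building ::
  "'i set \<Rightarrow> ('i \<Rightarrow> 'i \<Rightarrow> enat) \<Rightarrow> 'c set \<Rightarrow> ('i \<Rightarrow> ('c \<times> 'c) set) \<Rightarrow>
   ('c \<Rightarrow> 'c \<Rightarrow> 'i list set) \<Rightarrow> bool" where
  "building I M C R \<delta> \<longleftrightarrow>
     C \<noteq> {} \<and>
     (\<forall>i\<in>I. equiv C (R i)) \<and>
     (\<forall>i\<in>I. \<forall>P\<in>panels C R i. \<exists>c\<in>P. \<exists>d\<in>P. c \<noteq> d) \<and>
     (\<forall>c\<in>C. \<forall>d\<in>C. \<delta> c d \<in> carrier (coxeter_group I M)) \<and>
     (\<forall>w. coxeter_reduced I M w \<longrightarrow>
        (\<forall>c\<in>C. \<forall>d\<in>C. \<delta> c d = coxeter_word I M w \<longleftrightarrow> (\<exists>cs. gallery C R w c d cs)))"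

text \<open>The parameters are the cardinalities of the sets \<open>X i\<close>, compared by equipollence so that
  infinite cardinals are distinguished.\<close>

definition semiregular ::
  "'i set \<Rightarrow> 'c set \<Rightarrow> ('i \<Rightarrow> ('c \<times> 'c) set) \<Rightarrow> ('i \<Rightarrow> 'x set) \<Rightarrow> bool" where
  "semiregular I C R X \<longleftrightarrow> (\<forall>i\<in>I. \<forall>P\<in>panels C R i. P \<approx> X i)"

definition building_aut :: "'i set \<Rightarrow> 'c set \<Rightarrow> ('i \<Rightarrow> ('c \<times> 'c) set) \<Rightarrow> ('c \<Rightarrow> 'c) set" where
  "building_aut I C R =
     {g \<in> Bij C. \<forall>i\<in>I. \<forall>c\<in>C. \<forall>d\<in>C. (c, d) \<in> R i \<longleftrightarrow> (g c, g d) \<in> R i}"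

section \<open>Universal groups\<close>

definition legal_colouring ::
  "'i set \<Rightarrow> 'c set \<Rightarrow> ('i \<Rightarrow> ('c \<times> 'c) set) \<Rightarrow> ('i \<Rightarrow> 'x set) \<Rightarrow> ('i \<Rightarrow> 'c \<Rightarrow> 'x) \<Rightarrow> bool" where
  "legal_colouring I C R X lam \<longleftrightarrow>
     (\<forall>i\<in>I. lam i \<in> C \<rightarrow> X i) \<and>
     (\<forall>i\<in>I. \<forall>P\<in>panels C R i.
        bij_betw (lam i) P (X i) \<and> (\<forall>j\<in>I. j \<noteq> i \<longrightarrow> lam j constant_on P))"

definition local_action ::
  "('i \<Rightarrow> 'x set) \<Rightarrow> ('i \<Rightarrow> 'c \<Rightarrow> 'x) \<Rightarrow> 'i \<Rightarrow> ('c \<Rightarrow> 'c) \<Rightarrow> 'c set \<Rightarrow> 'x \<Rightarrow> 'x" where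
  "local_action X lam i g P = restrict (lam i \<circ> g \<circ> inv_into P (lam i)) (X i)"

definition universal_group ::
  "'i set \<Rightarrow> 'c set \<Rightarrow> ('i \<Rightarrow> ('c \<times> 'c) set) \<Rightarrow> ('i \<Rightarrow> 'x set) \<Rightarrow> ('i \<Rightarrow> 'c \<Rightarrow> 'x) \<Rightarrow>
   ('i \<Rightarrow> ('x \<Rightarrow> 'x) set) \<Rightarrow> ('c \<Rightarrow> 'c) set" where
  "universal_group I C R X lam F =
     {g \<in> building_aut I C R. \<forall>i\<in>I. \<forall>P\<in>panels C R i. local_action X lam i g P \<in> F i}"

section \<open>Permutation topology and compact generation\<close>

definition perm_group :: "'a set \<Rightarrow> ('a \<Rightarrow> 'a) set \<Rightarrow> ('a \<Rightarrow> 'a) monoid" where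
  "perm_group X G = BijGroup X\<lparr>carrier := G\<rparr>"

definition pointwise_stabilizer :: "('a \<Rightarrow> 'a) set \<Rightarrow> 'a set \<Rightarrow> ('a \<Rightarrow> 'a) set" where
  "pointwise_stabilizer G A = {g \<in> G. \<forall>x\<in>A. g x = x}"

text \<open>The group topology having the stabilisers of finite sets as neighbourhood basis of the
  identity: the neighbourhoods of \<open>g\<close> are the left translates by \<open>g\<close> of those of the identity.\<close>

definition perm_topology :: "'a set \<Rightarrow> ('a \<Rightarrow> 'a) set \<Rightarrow> ('a \<Rightarrow> 'a) topology" where
  "perm_topology X G = topology (\<lambda>U. U \<subseteq> G \<and>
     (\<forall>g\<in>U. \<exists>A. finite A \<and> A \<subseteq> X \<and> g <#\<^bsub>perm_group X G\<^esub> pointwise_stabilizer G A \<subseteq> U))"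

lemma openin_perm_topology:
  "openin (perm_topology X G) U \<longleftrightarrow> U \<subseteq> G \<and>
     (\<forall>g\<in>U. \<exists>A. finite A \<and> A \<subseteq> X \<and> g <#\<^bsub>perm_group X G\<^esub> pointwise_stabilizer G A \<subseteq> U)"
proof -
  let ?nb = "\<lambda>g A. g <#\<^bsub>perm_group X G\<^esub> pointwise_stabilizer G A"
  let ?op = "\<lambda>U. U \<subseteq> G \<and> (\<forall>g\<in>U. \<exists>A. finite A \<and> A \<subseteq> X \<and> ?nb g A \<subseteq> U)"
  have mono: "?nb g (A \<union> B) \<subseteq> ?nb g A \<inter> ?nb g B" for g A B
    by (auto simp: l_coset_def pointwise_stabilizer_def)
  have "istopology ?op"
    unfolding istopology_def
  proof (intro conjI allI impI)
    fix S T assume S: "?op S" and T: "?op T"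
    show "S \<inter> T \<subseteq> G" using S by blast
    show "\<forall>g\<in>S \<inter> T. \<exists>A. finite A \<and> A \<subseteq> X \<and> ?nb g A \<subseteq> S \<inter> T"
    proof
      fix g assume "g \<in> S \<inter> T"
      then obtain A B where A: "finite A" "A \<subseteq> X" "?nb g A \<subseteq> S"
        and B: "finite B" "B \<subseteq> X" "?nb g B \<subseteq> T"
        using S T by (meson IntE)
      have "?nb g (A \<union> B) \<subseteq> S \<inter> T"
        using mono[of g A B] A(3) B(3) by (meson Int_mono subset_trans)
      then show "\<exists>A. finite A \<and> A \<subseteq> X \<and> ?nb g A \<subseteq> S \<inter> T"
        using A B by (intro exI[of _ "A \<union> B"]) simp
    qed
  next
    fix \<K> assume K: "\<forall>U\<in>\<K>. ?op U"
    show "\<Union>\<K> \<subseteq> G" using K by blast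
    show "\<forall>g\<in>\<Union>\<K>. \<exists>A. finite A \<and> A \<subseteq> X \<and> ?nb g A \<subseteq> \<Union>\<K>"
    proof
      fix g assume "g \<in> \<Union>\<K>"
      then obtain U where U: "U \<in> \<K>" "g \<in> U" by (elim UnionE)
      with K obtain A where A: "finite A" "A \<subseteq> X" "?nb g A \<subseteq> U" by meson
      from A(3) Union_upper[OF U(1)] have "?nb g A \<subseteq> \<Union>\<K>" by (rule subset_trans)
      with A show "\<exists>A. finite A \<and> A \<subseteq> X \<and> ?nb g A \<subseteq> \<Union>\<K>" by (intro exI[of _ A] conjI)
    qed
  qed
  then show ?thesis unfolding perm_topology_def by (simp add: topology_inverse')
qed

lemma pointwise_coset_eq:
  assumes "subgroup G (BijGroup X)" "A \<subseteq> X" "g \<in> G"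
  shows "g <#\<^bsub>perm_group X G\<^esub> pointwise_stabilizer G A = {h \<in> G. \<forall>x\<in>A. h x = g x}"
proof -
  interpret B: group "BijGroup X" by (rule group_BijGroup)
  interpret G: subgroup G "BijGroup X" by fact
  have mult: "p \<otimes>\<^bsub>BijGroup X\<^esub> q = compose X p q" if "p \<in> G" "q \<in> G" for p q
    using that G.subset by (auto simp: BijGroup_def)
  have "\<exists>k\<in>pointwise_stabilizer G A. h = g \<otimes>\<^bsub>BijGroup X\<^esub> k"
    if h: "h \<in> G" "\<forall>x\<in>A. h x = g x" for h
  proof -
    let ?k = "inv\<^bsub>BijGroup X\<^esub> g \<otimes>\<^bsub>BijGroup X\<^esub> h"
    have gi: "inv\<^bsub>BijGroup X\<^esub> g \<in> G" using assms(3) by simp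
    have k: "?k \<in> G" using gi h by simp
    have eq: "h = g \<otimes>\<^bsub>BijGroup X\<^esub> ?k"
      using h(1) assms(3) by (simp add: B.m_assoc[symmetric] G.mem_carrier)
    have "inv\<^bsub>BijGroup X\<^esub> g \<otimes>\<^bsub>BijGroup X\<^esub> g = \<one>\<^bsub>BijGroup X\<^esub>"
      using assms(3) by (simp add: G.mem_carrier)
    then have cancel: "compose X (inv\<^bsub>BijGroup X\<^esub> g) g = (\<lambda>x\<in>X. x)"
      using mult[OF gi assms(3)] by (simp add: BijGroup_def)
    have "?k x = x" if "x \<in> A" for x
    proof -
      have "x \<in> X" using that assms(2) by blast
      then have "?k x = compose X (inv\<^bsub>BijGroup X\<^esub> g) g x"
        using h that gi by (simp add: mult compose_def)
      then show ?thesis using cancel \<open>x \<in> X\<close> by simp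
    qed
    with k eq show ?thesis unfolding pointwise_stabilizer_def by blast
  qed
  moreover have "g \<otimes>\<^bsub>BijGroup X\<^esub> k \<in> G \<and> (\<forall>x\<in>A. (g \<otimes>\<^bsub>BijGroup X\<^esub> k) x = g x)"
    if "k \<in> pointwise_stabilizer G A" for k
  proof -
    have k: "k \<in> G" "\<forall>x\<in>A. k x = x" using that by (simp_all add: pointwise_stabilizer_def)
    then show ?thesis
      using G.m_closed[OF assms(3) k(1)] mult[OF assms(3) k(1)] assms(2)
      by (auto simp: compose_def)
  qed
  ultimately show ?thesis by (auto simp: l_coset_def perm_group_def)
qed

definition compactly_generated :: "('a, 'b) monoid_scheme \<Rightarrow> 'a topology \<Rightarrow> bool" where
  "compactly_generated G T \<longleftrightarrow> (\<exists>K. K \<subseteq> carrier G \<and> compactin T K \<and> generate G K = carrier G)"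

end

theory Submission
  imports Defs
begin

text \<open>
  A legal colouring turns a chamber into something with coordinates: from a chamber \<open>z\<close>, a type \<open>i\<close>
  and a colour \<open>x\<close> one can move to the unique chamber of colour \<open>x\<close> in the \<open>i\<close>-panel of \<open>z\<close>. These
  moves overwrite one another within a type, commute for commuting types, and do nothing if the
  colour is already right. Since non-reduced words in a right-angled Coxeter group can be shortened by
  shuffling commuting letters and cancelling equal neighbours (\<open>reducible_split\<close>,
  \<open>irreducible_imp_reduced\<close>), these are the only relations between moves. Hence a rule that says
  how some other data change along a move, and that respects the three relations, defines a map
  on the whole building (\<open>transport\<close>). Applied to chambers as data, this produces an automorphism
  from any coherent family of local actions (\<open>automorphism_exists\<close>).

  Two families are used. The first applies one permutation \<open>f \<in> F i\<close> at all
  \<open>i\<close>-panels and the identity at all other panels (\<open>shift\<close>). For a fixed base chamber \<open>b\<close> this is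
  a continuous homomorphism from \<open>F i\<close> to the universal group \<open>U\<close>, so it carries a compact
  generating set of \<open>F i\<close> to a compact subset of \<open>U\<close>; the image of \<open>F i\<close> acts on
  the \<open>i\<close>-panel of \<open>b\<close> as \<open>F i\<close> acts on the colours. The second applies \<open>f\<close> only beyond a
  distant wall, and exists if \<open>i\<close> is not isolated, that is, if some type \<open>j \<noteq> i\<close> does not commute
  with \<open>i\<close>, and \<open>f\<close> fixes a given colour (\<open>remote_element\<close>).

  By local compactness the pointwise stabiliser in \<open>U\<close> of some finite set \<open>A\<close> of chambers is compact,
  so its orbits are finite. The remote elements realise every \<open>f \<in> F i\<close> that fixes a colour \<open>x\<close>, with
  \<open>i\<close> not isolated, as a local action of an element of that stabiliser. Therefore point stabilisers in \<open>F i\<close> have finite orbits for every non-isolated \<open>i\<close>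
  (\<open>point_stabilizer_finite_orbits\<close>).

  Let \<open>N\<close> be generated by the stabiliser of \<open>A\<close>, the compact sets of shifts based at finitely many
  chambers \<open>b \<in> B\<close> that represent the orbits of \<open>U\<close>, and finitely many further elements.
  As \<open>F i\<close> has finitely many orbits, every neighbour of a chamber in \<open>B\<close> is moved into \<open>B\<close>
  by \<open>N\<close>, and connectedness shows that \<open>N\<close> moves every chamber into \<open>B\<close>
  (\<open>subgroup_covers_chambers\<close>). This reduces an element of \<open>U\<close> to one that fixes a chamber \<open>c\<close>, and
  multiplication by shifts reduces it further to one that also fixes the panels of
  isolated type at \<open>c\<close> pointwise (\<open>fix_isolated_panels\<close>). The group of those elements has finite
  orbits: isolated types contribute nothing, and the others are controlled by the point stabilisers
  (\<open>panel_fixer_finite_orbits\<close>). So it lies in finitely many cosets of the stabiliser of \<open>A\<close>, and \<open>N\<close>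
  is all of \<open>U\<close>.
\<close>

section \<open>Words in a right-angled Coxeter group\<close>

text \<open>
The word problem is solved by letting the generators act on words up to shuffles of commuting
letters: a generator cancels against an equal letter that can be shuffled to the front, and is
prepended otherwise. This respects the Coxeter relations, so equivalent words have the same
normal form up to shuffling.
\<close>

locale commutation =
  fixes cm :: "'i \<Rightarrow> 'i \<Rightarrow> bool"
  assumes cm_sym: "cm i j \<Longrightarrow> cm j i" and cm_irrefl: "\<not> cm i i"
begin

primrec initial :: "'i \<Rightarrow> 'i list \<Rightarrow> bool" where
  "initial i [] \<longleftrightarrow> False"
| "initial i (k # w) \<longleftrightarrow> k = i \<or> cm i k \<and> initial i w"

primrec irreducible_word :: "'i list \<Rightarrow> bool" where
  "irreducible_word [] \<longleftrightarrow> True"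
| "irreducible_word (i # w) \<longleftrightarrow> \<not> initial i w \<and> irreducible_word w"

inductive shuffle :: "'i list \<Rightarrow> 'i list \<Rightarrow> bool" where
  shuffle_refl: "shuffle w w"
| shuffle_Cons: "shuffle u v \<Longrightarrow> shuffle (a # u) (a # v)"
| shuffle_swap: "cm a b \<Longrightarrow> shuffle (a # b # w) (b # a # w)"
| shuffle_trans [trans]: "shuffle u v \<Longrightarrow> shuffle v w \<Longrightarrow> shuffle u w"

definition left_mult :: "'i \<Rightarrow> 'i list \<Rightarrow> 'i list" where
  "left_mult i w = (if initial i w then remove1 i w else i # w)"

definition normal_form :: "'i list \<Rightarrow> 'i list" where
  "normal_form w = foldr left_mult w []"

lemma shuffle_length: "shuffle u v \<Longrightarrow> length u = length v"
  by (induction rule: shuffle.induct) auto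

lemma shuffle_initial: "shuffle u v \<Longrightarrow> initial i u = initial i v"
  by (induction rule: shuffle.induct) (auto dest: cm_sym)

lemma shuffle_remove1: "shuffle u v \<Longrightarrow> shuffle (remove1 i u) (remove1 i v)"
proof (induction rule: shuffle.induct)
  case (shuffle_swap a b w)
  then have "a \<noteq> b" using cm_irrefl by auto
  then show ?case
    using shuffle_swap by (auto intro: shuffle_refl shuffle.shuffle_swap)
qed (auto intro: shuffle_refl shuffle_Cons shuffle_trans)

lemma shuffle_left_mult: "shuffle u v \<Longrightarrow> shuffle (left_mult i u) (left_mult i v)"
  using shuffle_initial[of u v i] shuffle_remove1[of u v i]
  by (auto simp: left_mult_def intro: shuffle_Cons)

lemma shuffle_foldr_left_mult:
  "shuffle u v \<Longrightarrow> shuffle (foldr left_mult w u) (foldr left_mult w v)"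
  by (induction w) (auto intro: shuffle_left_mult)

lemma shuffle_initial_front: "initial i w \<Longrightarrow> shuffle (i # remove1 i w) w"
proof (induction w)
  case (Cons k w)
  show ?case
  proof (cases "k = i")
    case False
    then have "cm i k" "initial i w" using Cons.prems by auto
    then have "shuffle (i # k # remove1 i w) (k # i # remove1 i w)"
      "shuffle (k # i # remove1 i w) (k # w)"
      using Cons.IH by (auto intro: shuffle_swap shuffle_Cons)
    then show ?thesis using False by (auto intro: shuffle_trans)
  qed (auto intro: shuffle_refl)
qed auto

lemma initial_remove1_commuting: "cm i j \<Longrightarrow> initial j (remove1 i w) = initial j w"
  by (induction w) (auto dest: cm_sym simp: cm_irrefl)

lemma not_initial_remove1:
  "irreducible_word w \<Longrightarrow> initial i w \<Longrightarrow> \<not> initial i (remove1 i w)"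
  by (induction w) auto

lemma irreducible_remove1:
  "irreducible_word w \<Longrightarrow> initial i w \<Longrightarrow> irreducible_word (remove1 i w)"
  by (induction w) (auto simp: initial_remove1_commuting)

lemma irreducible_left_mult: "irreducible_word w \<Longrightarrow> irreducible_word (left_mult i w)"
  by (auto simp: left_mult_def irreducible_remove1)

lemma irreducible_foldr: "irreducible_word v \<Longrightarrow> irreducible_word (foldr left_mult w v)"
  by (induction w) (auto intro: irreducible_left_mult)

lemma irreducible_normal_form: "irreducible_word (normal_form w)"
  by (simp add: normal_form_def irreducible_foldr)

text \<open>
Irreducibility matters here: after cancelling a letter \<open>i\<close>, a second one must not be available at
the front, for otherwise the second multiplication would cancel again instead of restoring the word.
\<close>

lemma left_mult_involution:
  assumes "irreducible_word w"
  shows "shuffle (left_mult i (left_mult i w)) w"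
proof (cases "initial i w")
  case True
  then show ?thesis
    using not_initial_remove1[OF assms True] shuffle_initial_front[OF True]
    by (simp add: left_mult_def)
next
  case False
  then show ?thesis by (simp add: left_mult_def shuffle_refl)
qed

lemma left_mult_commute:
  assumes "cm i j"
  shows "shuffle (left_mult i (left_mult j w)) (left_mult j (left_mult i w))"
proof -
  have "i \<noteq> j" "cm j i" using assms cm_irrefl cm_sym by auto
  then show ?thesis
    using assms initial_remove1_commuting[of i j w] initial_remove1_commuting[of j i w]
    by (auto simp: left_mult_def remove1_commute shuffle_refl shuffle_swap)
qed

lemma normal_form_irreducible: "irreducible_word w \<Longrightarrow> normal_form w = w"
  by (induction w) (auto simp: normal_form_def left_mult_def)

lemma length_normal_form: "length (normal_form w) \<le> length w"
proof (induction w)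
  case (Cons i w)
  have "length (left_mult i v) \<le> Suc (length v)" for v
    by (auto simp: left_mult_def length_remove1)
  then show ?case using Cons by (simp add: normal_form_def) (meson le_trans Suc_le_mono)
qed (simp add: normal_form_def)

lemma initial_split:
  "initial i w \<Longrightarrow> \<exists>u b. w = u @ i # b \<and> (\<forall>k\<in>set u. cm i k)"
proof (induction w)
  case (Cons k w)
  show ?case
  proof (cases "k = i")
    case True
    then have "k # w = [] @ i # w \<and> (\<forall>l\<in>set []. cm i l)" by simp
    then show ?thesis by blast
  next
    case False
    then obtain u b where "w = u @ i # b" "\<forall>k\<in>set u. cm i k" "cm i k" using Cons by auto
    then have "k # w = (k # u) @ i # b \<and> (\<forall>l\<in>set (k # u). cm i l)" by simp
    then show ?thesis by blast
  qed
qed auto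

lemma reducible_split:
  "\<not> irreducible_word w \<Longrightarrow> \<exists>a i u b. w = a @ i # u @ i # b \<and> (\<forall>k\<in>set u. cm i k)"
proof (induction w)
  case (Cons i w)
  show ?case
  proof (cases "initial i w")
    case True
    then show ?thesis using initial_split[OF True] by (metis append_Nil)
  next
    case False
    then show ?thesis using Cons by (metis append_Cons irreducible_word.simps(2))
  qed
qed auto

end

definition commuting :: "'i set \<Rightarrow> ('i \<Rightarrow> 'i \<Rightarrow> enat) \<Rightarrow> 'i \<Rightarrow> 'i \<Rightarrow> bool" where
  "commuting I M i j \<longleftrightarrow> i \<in> I \<and> j \<in> I \<and> i \<noteq> j \<and> M i j = 2"

locale right_angled =
  fixes I :: "'i set" and M :: "'i \<Rightarrow> 'i \<Rightarrow> enat"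
  assumes matrix: "right_angled_coxeter_matrix I M"
begin

sublocale commutation "commuting I M"
  by unfold_locales (use matrix in \<open>auto simp: commuting_def right_angled_coxeter_matrix_def\<close>)

lemma shuffle_normal_form:
  "coxeter_equiv I M u v \<Longrightarrow> shuffle (normal_form u) (normal_form v)"
proof (induction rule: coxeter_equiv.induct)
  case (sym v w)
  have "shuffle u v \<Longrightarrow> shuffle v u" for u v
    by (induction rule: shuffle.induct)
        (auto intro: shuffle_refl shuffle_Cons shuffle_swap cm_sym intro: shuffle_trans)
  then show ?case using sym by simp
next
  case (relation u v i j m)
  let ?v = "normal_form v"
  have irr: "irreducible_word ?v" by (rule irreducible_normal_form)
  have "shuffle (foldr left_mult (concat (replicate m [i, j])) ?v) ?v"
  proof (cases "i = j")
    case True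
    then have "m = 1"
      using relation matrix by (auto simp: right_angled_coxeter_matrix_def one_enat_def)
    then show ?thesis using True left_mult_involution[OF irr] by simp
  next
    case False
    then have "enat m = 2" and ij: "commuting I M i j"
      using relation matrix unfolding right_angled_coxeter_matrix_def commuting_def
      by (metis empty_iff enat.distinct(1) insert_iff)+
    then have "m = 2" by (metis enat.inject numeral_eq_enat)
    have "shuffle (left_mult i (left_mult j (left_mult i (left_mult j ?v))))
        (left_mult i (left_mult i (left_mult j (left_mult j ?v))))"
      by (rule shuffle_left_mult[OF left_mult_commute[OF cm_sym[OF ij]]])
    also have "shuffle \<dots> (left_mult j (left_mult j ?v))"
      by (intro left_mult_involution irreducible_left_mult irr)
    also have "shuffle \<dots> ?v" by (intro left_mult_involution irr)
    finally show ?thesis using \<open>m = 2\<close> by (simp add: numeral_2_eq_2)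
  qed
  from shuffle_foldr_left_mult[OF this, of u] show ?case by (simp add: normal_form_def)
qed (auto intro: shuffle_refl elim: shuffle_trans)

text \<open>
An irreducible word is its own normal form, and normal forms of equivalent words have the same
length, while passing to the normal form never lengthens a word.
\<close>

lemma irreducible_imp_reduced:
  assumes "irreducible_word w" "w \<in> lists I"
  shows "coxeter_reduced I M w"
  unfolding coxeter_reduced_def
proof (intro conjI ballI impI)
  fix v assume v: "v \<in> lists I" "coxeter_word I M v = coxeter_word I M w"
  then have "coxeter_equiv I M v w"
    using assms by (simp add: coxeter_word_eq_class coxeter_class_eq_iff)
  from shuffle_length[OF shuffle_normal_form[OF this]] show "length w \<le> length v"
    using length_normal_form[of v] normal_form_irreducible[OF assms(1)] by simp
qed (use assms in simp)

end

section \<open>Colours as coordinates on the building\<close>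

text \<open>
Existence of galleries is put into recursive form, which is the form needed for inductions on words.
\<close>

lemma gallery_Nil_iff: "(\<exists>cs. gallery C R [] c d cs) \<longleftrightarrow> c = d \<and> c \<in> C"
proof
  assume "\<exists>cs. gallery C R [] c d cs"
  then show "c = d \<and> c \<in> C" by (fastforce simp: gallery_def length_Suc_conv)
next
  assume "c = d \<and> c \<in> C"
  then have "gallery C R [] c d [c]" by (auto simp: gallery_def)
  then show "\<exists>cs. gallery C R [] c d cs" by blast
qed

lemma gallery_Cons_iff:
  "(\<exists>cs. gallery C R (i # w) c d cs) \<longleftrightarrow>
     c \<in> C \<and> (\<exists>c'. (c, c') \<in> R i \<and> c \<noteq> c' \<and> (\<exists>cs. gallery C R w c' d cs))"
proof
  assume "\<exists>cs. gallery C R (i # w) c d cs"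
  then obtain cs where g: "gallery C R (i # w) c d cs" by blast
  then obtain cs' where cs: "cs = c # cs'" by (cases cs) (auto simp: gallery_def)
  have "gallery C R w (cs' ! 0) d cs'" using g unfolding cs gallery_def by fastforce
  moreover have "(c, cs' ! 0) \<in> R i" "c \<noteq> cs' ! 0" "c \<in> C"
    using g unfolding cs gallery_def by fastforce+
  ultimately show "c \<in> C \<and> (\<exists>c'. (c, c') \<in> R i \<and> c \<noteq> c' \<and> (\<exists>cs. gallery C R w c' d cs))"
    by blast
next
  assume "c \<in> C \<and> (\<exists>c'. (c, c') \<in> R i \<and> c \<noteq> c' \<and> (\<exists>cs. gallery C R w c' d cs))"
  then obtain c' cs where "c \<in> C" "(c, c') \<in> R i" "c \<noteq> c'" "gallery C R w c' d cs" by blast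
  then have "gallery C R (i # w) c d (c # cs)"
    by (auto simp: gallery_def nth_Cons split: nat.splits)
  then show "\<exists>cs. gallery C R (i # w) c d cs" by blast
qed

locale coloured_building = right_angled I M
  for I :: "'i set" and M :: "'i \<Rightarrow> 'i \<Rightarrow> enat" +
  fixes C :: "'c set" and R :: "'i \<Rightarrow> ('c \<times> 'c) set" and \<delta> :: "'c \<Rightarrow> 'c \<Rightarrow> 'i list set"
    and X :: "'i \<Rightarrow> 'x set" and lam :: "'i \<Rightarrow> 'c \<Rightarrow> 'x"
  assumes building: "building I M C R \<delta>" and colouring: "legal_colouring I C R X lam"
begin

definition joined :: "'i list \<Rightarrow> 'c \<Rightarrow> 'c \<Rightarrow> bool" where
  "joined w c d \<longleftrightarrow> (\<exists>cs. gallery C R w c d cs)"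

lemma joined_Nil [simp]: "joined [] c d \<longleftrightarrow> c = d \<and> c \<in> C"
  by (simp add: joined_def gallery_Nil_iff)

lemma joined_Cons [simp]:
  "joined (i # w) c d \<longleftrightarrow> c \<in> C \<and> (\<exists>c'. (c, c') \<in> R i \<and> c \<noteq> c' \<and> joined w c' d)"
  by (simp add: joined_def gallery_Cons_iff)

lemma joined_iff:
  "coxeter_reduced I M w \<Longrightarrow> c \<in> C \<Longrightarrow> d \<in> C \<Longrightarrow> joined w c d \<longleftrightarrow> \<delta> c d = coxeter_word I M w"
  using building unfolding building_def joined_def by blast

lemma equiv_R: "i \<in> I \<Longrightarrow> equiv C (R i)"
  using building by (simp add: building_def)

lemma R_refl: "i \<in> I \<Longrightarrow> z \<in> C \<Longrightarrow> (z, z) \<in> R i"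
  using equiv_R equiv_class_self by fastforce

lemma R_sym: "i \<in> I \<Longrightarrow> (z, z') \<in> R i \<Longrightarrow> (z', z) \<in> R i"
  using equiv_R by (meson equivE symE)

lemma R_trans: "i \<in> I \<Longrightarrow> (z, z') \<in> R i \<Longrightarrow> (z', z'') \<in> R i \<Longrightarrow> (z, z'') \<in> R i"
  using equiv_R by (meson equivE transE)

lemma R_in: "i \<in> I \<Longrightarrow> (z, z') \<in> R i \<Longrightarrow> z \<in> C \<and> z' \<in> C"
  using equiv_R by (metis equiv_class_eq_iff)

lemma panel: "i \<in> I \<Longrightarrow> z \<in> C \<Longrightarrow> R i `` {z} \<in> panels C R i"
  by (simp add: panels_def quotientI)

lemma lam_bij: "i \<in> I \<Longrightarrow> z \<in> C \<Longrightarrow> bij_betw (lam i) (R i `` {z}) (X i)"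
  using colouring panel by (auto simp: legal_colouring_def)

lemma lam_in: "i \<in> I \<Longrightarrow> z \<in> C \<Longrightarrow> lam i z \<in> X i"
  using colouring by (auto simp: legal_colouring_def)

lemma lam_adjacent:
  assumes "i \<in> I" "j \<in> I" "i \<noteq> j" "(z, z') \<in> R j"
  shows "lam i z' = lam i z"
proof -
  have z: "z \<in> C" using R_in assms by blast
  then have "lam i constant_on (R j `` {z})"
    using colouring panel[of j z] assms by (auto simp: legal_colouring_def)
  then show ?thesis using R_refl[of j z] z assms unfolding constant_on_def by fastforce
qed

text \<open>
Since \<open>lam i\<close> is a bijection on each \<open>i\<close>-panel, the description below determines a chamber whenever
\<open>x \<in> X i\<close>.
\<close>

definition move :: "'i \<Rightarrow> 'x \<Rightarrow> 'c \<Rightarrow> 'c" where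
  "move i x z = (THE z'. (z, z') \<in> R i \<and> lam i z' = x)"

lemma move_ex1:
  assumes "i \<in> I" "x \<in> X i" "z \<in> C"
  shows "\<exists>!z'. (z, z') \<in> R i \<and> lam i z' = x"
proof -
  have "inj_on (lam i) (R i `` {z})" "x \<in> lam i ` (R i `` {z})"
    using lam_bij[of i z] assms by (auto simp: bij_betw_def)
  then show ?thesis unfolding inj_on_def by fastforce
qed

lemma move_R: "i \<in> I \<Longrightarrow> x \<in> X i \<Longrightarrow> z \<in> C \<Longrightarrow> (z, move i x z) \<in> R i"
  and lam_move [simp]: "i \<in> I \<Longrightarrow> x \<in> X i \<Longrightarrow> z \<in> C \<Longrightarrow> lam i (move i x z) = x"
  using theI'[OF move_ex1] unfolding move_def by fast+

lemma move_in [simp]: "i \<in> I \<Longrightarrow> x \<in> X i \<Longrightarrow> z \<in> C \<Longrightarrow> move i x z \<in> C"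
  using move_R R_in by blast

lemma move_eqI:
  assumes "i \<in> I" "(z, z') \<in> R i" "lam i z' = x"
  shows "move i x z = z'"
proof -
  have "z \<in> C" "z' \<in> C" using R_in assms by auto
  then have "x \<in> X i" using assms lam_in by auto
  then show ?thesis
    using move_ex1[OF assms(1) _ \<open>z \<in> C\<close>] move_R lam_move \<open>z \<in> C\<close> assms by metis
qed

lemma lam_move_other [simp]:
  "i \<in> I \<Longrightarrow> x \<in> X i \<Longrightarrow> z \<in> C \<Longrightarrow> j \<in> I \<Longrightarrow> j \<noteq> i \<Longrightarrow> lam j (move i x z) = lam j z"
  using lam_adjacent[of j i z "move i x z"] move_R by blast

lemma move_stay [simp]: "i \<in> I \<Longrightarrow> z \<in> C \<Longrightarrow> move i (lam i z) z = z"
  by (rule move_eqI) (auto intro: R_refl)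

lemma move_panel:
  assumes "i \<in> I" "x \<in> X i" "(z, z') \<in> R i"
  shows "move i x z' = move i x z"
proof -
  have "z \<in> C" using assms R_in by blast
  then show ?thesis
    using assms by (intro move_eqI) (auto intro: R_trans R_sym move_R)
qed

lemma move_move [simp]:
  "i \<in> I \<Longrightarrow> x \<in> X i \<Longrightarrow> y \<in> X i \<Longrightarrow> z \<in> C \<Longrightarrow> move i x (move i y z) = move i x z"
  by (rule move_panel) (auto intro: move_R)

lemma coxeter_swap:
  assumes "commuting I M i j"
  shows "coxeter_word I M [i, j] = coxeter_word I M [j, i]"
proof -
  have ij: "i \<in> I" "j \<in> I" "M i j = enat 2" "M i i = enat 1" "M j j = enat 1"
    using assms matrix
    by (auto simp: commuting_def right_angled_coxeter_matrix_def one_enat_def numeral_eq_enat)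
  have "coxeter_equiv I M ([] @ concat (replicate 2 [i, j]) @ [j, i]) ([] @ [j, i])"
    "coxeter_equiv I M ([i, j, i] @ concat (replicate 1 [j, j]) @ [i]) ([i, j, i] @ [i])"
    "coxeter_equiv I M ([i, j] @ concat (replicate 1 [i, i]) @ []) ([i, j] @ [])"
    by (rule coxeter_equiv.relation; use ij in simp)+
  then have "coxeter_equiv I M [i, j, i, j, j, i] [j, i]"
    "coxeter_equiv I M [i, j, i, j, j, i] [i, j, i, i]" "coxeter_equiv I M [i, j, i, i] [i, j]"
    by (simp_all add: numeral_2_eq_2)
  then have "coxeter_equiv I M [i, j] [j, i]" by (meson coxeter_equiv.sym coxeter_equiv.trans)
  then show ?thesis using ij by (simp add: coxeter_word_eq_class coxeter_class_eq_iff)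
qed

text \<open>
If both moves are proper, they form a gallery of type \<open>[i, j]\<close>. That word and \<open>[j, i]\<close> are reduced
and represent the same element, so there is also a gallery of type \<open>[j, i]\<close>; comparing colours
identifies its middle chamber. An improper move stays improper after the other one.
\<close>

lemma move_commute:
  assumes ij: "commuting I M i j" and x: "x \<in> X i" and y: "y \<in> X j" and z: "z \<in> C"
  shows "move j y (move i x z) = move i x (move j y z)"
proof -
  have I: "i \<in> I" "j \<in> I" "i \<noteq> j" using ij by (auto simp: commuting_def)
  let ?c = "move j y (move i x z)"
  consider "x = lam i z" | "y = lam j z" | "x \<noteq> lam i z" "y \<noteq> lam j z" by blast
  then show ?thesis
  proof cases
    case 1
    then have "move i x (move j y z) = move i (lam i (move j y z)) (move j y z)" using I y z by simp
    then show ?thesis using 1 I y z move_stay[of i "move j y z"] by simp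
  next
    case 2
    then have "?c = move j (lam j (move i x z)) (move i x z)" using I x z by simp
    then show ?thesis using 2 I x z move_stay[of j "move i x z"] by simp
  next
    case 3
    have red: "coxeter_reduced I M [i, j]" "coxeter_reduced I M [j, i]"
      using I ij cm_irrefl by (auto intro!: irreducible_imp_reduced)
    have "z \<noteq> move i x z" "move i x z \<noteq> ?c"
      using 3 I x y z by (metis lam_move, metis lam_move lam_move_other move_in)
    moreover have "(z, move i x z) \<in> R i" "(move i x z, ?c) \<in> R j" "move i x z \<in> C" "?c \<in> C"
      using I x y z move_R by auto
    ultimately have "joined [i, j] z ?c" unfolding joined_Cons joined_Nil using z by blast
    then have "joined [j, i] z ?c"
      using red I x y z by (simp only: joined_iff move_in coxeter_swap[OF ij])
    then obtain z' where z': "(z, z') \<in> R j" "(z', ?c) \<in> R i" by auto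
    have "lam i ?c = x" "lam j ?c = y" using I x y z by auto
    then have "lam j z' = y" using lam_adjacent[of j i z' ?c] z' I by auto
    then have "z' = move j y z" using move_eqI[OF I(2) z'(1)] by simp
    then show ?thesis using move_eqI[OF I(1) z'(2) \<open>lam i ?c = x\<close>] by simp
  qed
qed

lemma reduced_gallery:
  assumes "z \<in> C" "z' \<in> C"
  obtains w where "coxeter_reduced I M w" "joined w z z'"
proof -
  have "\<delta> z z' \<in> carrier (coxeter_group I M)" using building assms by (simp add: building_def)
  then obtain v where "v \<in> lists I" "\<delta> z z' = coxeter_class I M v"
    by (auto simp: coxeter_group_def)
  then have "v \<in> lists I \<and> coxeter_word I M v = \<delta> z z'" by (simp add: coxeter_word_eq_class)
  then obtain w where w: "w \<in> lists I" "coxeter_word I M w = \<delta> z z'"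
      "\<forall>u. u \<in> lists I \<and> coxeter_word I M u = \<delta> z z' \<longrightarrow> length w \<le> length u"
    using ex_has_least_nat[of "\<lambda>w. w \<in> lists I \<and> coxeter_word I M w = \<delta> z z'" v length] by blast
  then have "coxeter_reduced I M w" by (auto simp: coxeter_reduced_def)
  then show ?thesis using that w assms joined_iff by metis
qed

lemma reduced_closed_gallery:
  assumes "coxeter_reduced I M w" "joined w z z"
  shows "w = []"
proof -
  have z: "z \<in> C" using assms(2) by (cases w) auto
  have nil: "coxeter_reduced I M []" by (simp add: coxeter_reduced_def)
  then have "coxeter_word I M [] = coxeter_word I M w" using joined_iff assms z joined_Nil by metis
  then have "length w \<le> length ([] :: 'i list)"
    using assms(1) unfolding coxeter_reduced_def by blast
  then show ?thesis by simp
qed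

text \<open>
Connectedness of the building as an induction principle.
\<close>

lemma chamber_induct [consumes 2, case_names base move]:
  assumes "c \<in> C" "z \<in> C" "P c"
    and "\<And>z i x. \<lbrakk>z \<in> C; i \<in> I; x \<in> X i; P z\<rbrakk> \<Longrightarrow> P (move i x z)"
  shows "P z"
proof -
  obtain w where w: "coxeter_reduced I M w" "joined w c z" using reduced_gallery assms by blast
  have "w \<in> lists I" using w by (simp add: coxeter_reduced_def)
  then show "P z" using w(2) assms(1,3)
  proof (induction w arbitrary: c)
    case (Cons i w)
    then obtain c' where c': "(c, c') \<in> R i" "joined w c' z" and i: "i \<in> I" by auto
    then have "c' = move i (lam i c') c" "c' \<in> C" "lam i c' \<in> X i"
      using move_eqI R_in lam_in by metis+
    then have "P c'" using assms(4) Cons.prems i by metis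
    then show ?case using Cons c' \<open>c' \<in> C\<close> by auto
  qed auto
qed

end

text \<open>
A chamber \<open>z\<close> is carried along together with a state \<open>m\<close>, and \<open>step i x z m\<close> is the state
after the move to colour \<open>x\<close> in the \<open>i\<close>-panel of \<open>z\<close>. The assumptions require of the states the same
relations that hold between moves of chambers.
\<close>

locale colour_transport = coloured_building I M C R \<delta> X lam
  for I :: "'i set" and M :: "'i \<Rightarrow> 'i \<Rightarrow> enat" and C :: "'c set" and R :: "'i \<Rightarrow> ('c \<times> 'c) set"
    and \<delta> :: "'c \<Rightarrow> 'c \<Rightarrow> 'i list set" and X :: "'i \<Rightarrow> 'x set" and lam :: "'i \<Rightarrow> 'c \<Rightarrow> 'x" +
  fixes step :: "'i \<Rightarrow> 'x \<Rightarrow> 'c \<Rightarrow> 'm \<Rightarrow> 'm" and Inv :: "'c \<Rightarrow> 'm \<Rightarrow> bool"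
  assumes invariant:
      "\<lbrakk>z \<in> C; i \<in> I; x \<in> X i; Inv z m\<rbrakk> \<Longrightarrow> Inv (move i x z) (step i x z m)"
    and stationary: "\<lbrakk>z \<in> C; i \<in> I; Inv z m\<rbrakk> \<Longrightarrow> step i (lam i z) z m = m"
    and overwrite: "\<lbrakk>z \<in> C; i \<in> I; x \<in> X i; y \<in> X i; Inv z m\<rbrakk> \<Longrightarrow>
      step i y (move i x z) (step i x z m) = step i y z m"
    and interchange: "\<lbrakk>z \<in> C; commuting I M i j; x \<in> X i; y \<in> X j; Inv z m\<rbrakk> \<Longrightarrow>
      step j y (move i x z) (step i x z m) = step i x (move j y z) (step j y z m)"
begin

definition letters :: "('i \<times> 'x) set" where
  "letters = {(i, x). i \<in> I \<and> x \<in> X i}"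

fun joint_step :: "'i \<times> 'x \<Rightarrow> 'c \<times> 'm \<Rightarrow> 'c \<times> 'm" where
  "joint_step (i, x) (z, m) = (move i x z, step i x z m)"

lemma joint_step_eq: "joint_step (i, x) p = (move i x (fst p), step i x (fst p) (snd p))"
  by (cases p) simp

definition admissible :: "'c \<times> 'm \<Rightarrow> bool" where
  "admissible p \<longleftrightarrow> fst p \<in> C \<and> Inv (fst p) (snd p)"

lemma admissible_step: "a \<in> letters \<Longrightarrow> admissible p \<Longrightarrow> admissible (joint_step a p)"
  by (cases a; cases p) (auto simp: letters_def admissible_def invariant)

lemma admissible_fold:
  "set u \<subseteq> letters \<Longrightarrow> admissible p \<Longrightarrow> admissible (fold joint_step u p)"
  by (induction u arbitrary: p) (auto simp: admissible_step)

lemma joint_stationary: "i \<in> I \<Longrightarrow> admissible p \<Longrightarrow> joint_step (i, lam i (fst p)) p = p"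
  by (cases p) (auto simp: admissible_def stationary)

lemma joint_overwrite:
  "(i, x) \<in> letters \<Longrightarrow> (i, y) \<in> letters \<Longrightarrow> admissible p \<Longrightarrow>
    joint_step (i, y) (joint_step (i, x) p) = joint_step (i, y) p"
  by (cases p) (auto simp: letters_def admissible_def overwrite)

lemma joint_interchange:
  assumes "set t \<subseteq> letters" "(i, x) \<in> letters" "\<forall>a\<in>set t. commuting I M i (fst a)"
    "admissible p"
  shows "fold joint_step t (joint_step (i, x) p) = joint_step (i, x) (fold joint_step t p)"
  using assms
proof (induction t arbitrary: p)
  case (Cons a t)
  obtain j y where a: "a = (j, y)" by (cases a)
  obtain z m where p: "p = (z, m)" by (cases p)
  have "joint_step a (joint_step (i, x) p) = joint_step (i, x) (joint_step a p)"
    using Cons.prems move_commute[of i j x y z] interchange[of z i j x y m]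
    by (simp add: a p letters_def admissible_def)
  then show ?case using Cons admissible_step[of a p] by simp
qed simp

lemma proper_steps_joined:
  assumes "set u \<subseteq> letters" "admissible p"
    and "\<And>a i x b. u = a @ (i, x) # b \<Longrightarrow> lam i (fst (fold joint_step a p)) \<noteq> x"
  shows "joined (map fst u) (fst p) (fst (fold joint_step u p))"
  using assms
proof (induction u arbitrary: p)
  case Nil
  then show ?case by (simp add: admissible_def)
next
  case (Cons l u)
  obtain i x where l: "l = (i, x)" by (cases l)
  have ix: "i \<in> I" "x \<in> X i" and z: "fst p \<in> C"
    using Cons.prems by (auto simp: l letters_def admissible_def)
  have fst_step: "fst (joint_step l p) = move i x (fst p)" by (cases p) (simp add: l)
  have "joined (map fst u) (fst (joint_step l p)) (fst (fold joint_step u (joint_step l p)))"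
  proof (rule Cons.IH)
    show "lam i (fst (fold joint_step a (joint_step l p))) \<noteq> x" if "u = a @ (i, x) # b" for a i x b
      using Cons.prems(3)[of "l # a" i x b] that by simp
  qed (use Cons.prems admissible_step in auto)
  moreover have "lam i (fst p) \<noteq> x" using Cons.prems(3)[of "[]" i x u] l by simp
  then have "fst p \<noteq> move i x (fst p)" using ix z by (metis lam_move)
  ultimately show ?case using fst_step ix z move_R[of i x "fst p"] by (auto simp: l)
qed

text \<open>
The state depends only on the chamber because a closed path returns to its initial state.
An improper step can be dropped. A reducible type has two letters \<open>i\<close> that can be shuffled next to
each other, and then the second overwrites the first. Both operations shorten the path without
changing its result. What remains is a closed gallery of reduced type, which is empty.
\<close>

lemma closed_path:
  assumes "set u \<subseteq> letters" "admissible p" "fst (fold joint_step u p) = fst p"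
  shows "fold joint_step u p = p"
  using assms
proof (induction "length u" arbitrary: u rule: less_induct)
  case less
  show ?case
  proof (cases "\<exists>a i x b. u = a @ (i, x) # b \<and> lam i (fst (fold joint_step a p)) = x")
    case True
    then obtain a i x b where u: "u = a @ (i, x) # b" "lam i (fst (fold joint_step a p)) = x"
      by blast
    have "joint_step (i, x) (fold joint_step a p) = fold joint_step a p"
      using less.prems u joint_stationary[of i "fold joint_step a p"] admissible_fold
      by (auto simp: letters_def)
    then have "fold joint_step u p = fold joint_step (a @ b) p" using u by simp
    then show ?thesis using less.hyps[of "a @ b"] less.prems u by auto
  next
    case False
    show ?thesis
    proof (cases "irreducible_word (map fst u)")
      case True
      have "joined (map fst u) (fst p) (fst (fold joint_step u p))"
        using proper_steps_joined less.prems False by blast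
      moreover have "coxeter_reduced I M (map fst u)"
        using irreducible_imp_reduced[OF True] less.prems(1)
        by (fastforce simp: letters_def in_lists_conv_set)
      ultimately have "map fst u = []" using reduced_closed_gallery less.prems(3) by metis
      then show ?thesis by simp
    next
      case reducible: False
      obtain a' i t' b' where "map fst u = a' @ i # t' @ i # b'"
        "\<forall>k\<in>set t'. commuting I M i k"
        using reducible_split[OF reducible] by blast
      then obtain a x t y b where u: "u = a @ (i, x) # t @ (i, y) # b"
        and t: "\<forall>l\<in>set t. commuting I M i (fst l)"
        by (fastforce simp: map_eq_append_conv map_eq_Cons_conv append_eq_map_conv Cons_eq_map_conv)
      let ?q = "fold joint_step a p"
      have q: "admissible ?q" using less.prems u admissible_fold by simp
      have "joint_step (i, y) (fold joint_step t (joint_step (i, x) ?q)) =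
          joint_step (i, y) (joint_step (i, x) (fold joint_step t ?q))"
        using joint_interchange[OF _ _ t q] less.prems u by simp
      also have "\<dots> = joint_step (i, y) (fold joint_step t ?q)"
        using joint_overwrite admissible_fold q less.prems u by simp
      finally have "fold joint_step u p = fold joint_step (a @ t @ (i, y) # b) p"
        by (simp add: u)
      then show ?thesis using less.hyps[of "a @ t @ (i, y) # b"] less.prems u by auto
    qed
  qed
qed

lemma return_path:
  assumes "set u \<subseteq> letters" "admissible p"
  shows "\<exists>r. set r \<subseteq> letters \<and> fold joint_step r (fold joint_step u p) = p"
  using assms
proof (induction u arbitrary: p)
  case (Cons l u)
  obtain i x where l: "l = (i, x)" by (cases l)
  obtain r where r: "set r \<subseteq> letters"
      "fold joint_step r (fold joint_step u (joint_step l p)) = joint_step l p"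
    using Cons.IH[of "joint_step l p"] Cons.prems admissible_step by auto
  let ?l = "(i, lam i (fst p))"
  have "?l \<in> letters" using Cons.prems lam_in by (auto simp: l letters_def admissible_def)
  then have "joint_step ?l (joint_step l p) = p"
    using joint_overwrite[of i x "lam i (fst p)" p] joint_stationary[of i p] Cons.prems
    by (auto simp: l letters_def)
  then show ?case using r \<open>?l \<in> letters\<close> by (intro exI[of _ "r @ [?l]"]) simp
qed (intro exI[of _ "[]"], simp)

text \<open>
Two paths from \<open>c\<close> to the same chamber give the same state, since one of them followed by
the way back along the other is a closed path. So the state at the end of any path is a function of the chamber.
\<close>

theorem transport:
  assumes c: "c \<in> C" "Inv c m"
  shows "\<exists>h. h c = m \<and> (\<forall>z\<in>C. Inv z (h z)) \<and>
    (\<forall>z\<in>C. \<forall>i\<in>I. \<forall>x\<in>X i. h (move i x z) = step i x z (h z))"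
proof -
  let ?p = "(c, m)" and ?end = "\<lambda>u. fold joint_step u (c, m)"
  have p: "admissible ?p" using c by (simp add: admissible_def)
  have unique: "?end u = ?end v"
    if uv: "set u \<subseteq> letters" "set v \<subseteq> letters" "fst (?end u) = fst (?end v)" for u v
  proof -
    obtain r where "set r \<subseteq> letters" "fold joint_step r (?end v) = ?p"
      using return_path[OF uv(2) p] by blast
    then show ?thesis using closed_path[of "r @ u" "?end v"] uv p admissible_fold by simp
  qed
  define path where "path z = (SOME u. set u \<subseteq> letters \<and> fst (?end u) = z)" for z
  have path: "set (path z) \<subseteq> letters \<and> fst (?end (path z)) = z" if "z \<in> C" for z
    unfolding path_def
  proof (rule someI_ex)
    show "\<exists>u. set u \<subseteq> letters \<and> fst (?end u) = z" using c(1) that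
    proof (induction rule: chamber_induct)
      case base
      show ?case by (intro exI[of _ "[]"]) simp
    next
      case (move z i x)
      then obtain u where u: "set u \<subseteq> letters" "fst (?end u) = z" by blast
      have "fst (joint_step (i, x) (?end u)) = move i x z" using u by (cases "?end u") simp
      then show ?case using u move by (intro exI[of _ "u @ [(i, x)]"]) (simp add: letters_def)
    qed
  qed
  let ?h = "\<lambda>z. snd (?end (path z))"
  have pair: "?end (path z) = (z, ?h z)" if "z \<in> C" for z
    using path[OF that] by (metis prod.collapse)
  have h: "?end u = (z, ?h z)" if "set u \<subseteq> letters" "fst (?end u) = z" "z \<in> C" for u z
    using unique[of u "path z"] path[OF that(3)] pair that by simp
  show ?thesis
  proof (intro exI[of _ ?h] conjI ballI)
    show "?h c = m" using h[of "[]" c] c by simp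
    show "Inv z (?h z)" if "z \<in> C" for z
      using admissible_fold[of "path z" ?p] path[OF that] p pair[OF that]
      by (simp add: admissible_def)
    show "?h (move i x z) = step i x z (?h z)" if z: "z \<in> C" "i \<in> I" "x \<in> X i" for z i x
    proof -
      have "?end (path z @ [(i, x)]) = (move i x z, step i x z (?h z))"
        using path[OF z(1)] by (simp add: joint_step_eq)
      then show ?thesis
        using h[of "path z @ [(i, x)]" "move i x z"] path[OF z(1)] z by (simp add: letters_def)
    qed
  qed
qed

end

section \<open>Automorphisms with prescribed local actions\<close>

lemma BijGroup_simps [simp]:
  "carrier (BijGroup S) = Bij S" "\<one>\<^bsub>BijGroup S\<^esub> = (\<lambda>x\<in>S. x)"
  by (simp_all add: BijGroup_def)

lemma BijGroup_mult: "f \<in> Bij S \<Longrightarrow> g \<in> Bij S \<Longrightarrow> f \<otimes>\<^bsub>BijGroup S\<^esub> g = compose S f g"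
  by (simp add: BijGroup_def)

lemma BijGroup_inv_apply:
  assumes "g \<in> Bij S" "x \<in> S"
  shows "(inv\<^bsub>BijGroup S\<^esub> g) (g x) = x" "g ((inv\<^bsub>BijGroup S\<^esub> g) x) = x"
    "(inv\<^bsub>BijGroup S\<^esub> g) x \<in> S" "g x \<in> S"
proof -
  have b: "bij_betw g S S" using assms by (simp add: Bij_def)
  then show gx: "g x \<in> S" using assms by (auto simp: bij_betw_def)
  show "(inv\<^bsub>BijGroup S\<^esub> g) (g x) = x" "g ((inv\<^bsub>BijGroup S\<^esub> g) x) = x"
    "(inv\<^bsub>BijGroup S\<^esub> g) x \<in> S"
    using b assms gx
    by (auto simp: inv_BijGroup bij_betw_inv_into_left bij_betw_inv_into_right Bij_inv_into_mem)
qed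

context coloured_building
begin

abbreviation Aut :: "('c \<Rightarrow> 'c) set" where
  "Aut \<equiv> building_aut I C R"

lemma aut_Bij: "g \<in> Aut \<Longrightarrow> g \<in> Bij C"
  by (simp add: building_aut_def)

lemma aut_in: "g \<in> Aut \<Longrightarrow> z \<in> C \<Longrightarrow> g z \<in> C"
  by (rule BijGroup_inv_apply(4)[OF aut_Bij])

lemma aut_R: "g \<in> Aut \<Longrightarrow> i \<in> I \<Longrightarrow> z \<in> C \<Longrightarrow> z' \<in> C \<Longrightarrow> (g z, g z') \<in> R i \<longleftrightarrow> (z, z') \<in> R i"
  by (auto simp: building_aut_def)

lemma AutI:
  assumes "g \<in> Bij C"
    and "\<And>i z z'. \<lbrakk>i \<in> I; z \<in> C; z' \<in> C\<rbrakk> \<Longrightarrow> (g z, g z') \<in> R i \<longleftrightarrow> (z, z') \<in> R i"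
  shows "g \<in> Aut"
  unfolding building_aut_def using assms by blast

lemma aut_eqI:
  assumes "g \<in> Aut" "h \<in> Aut" "\<And>z. z \<in> C \<Longrightarrow> g z = h z"
  shows "g = h"
  using assms(3) Bij_imp_extensional[OF aut_Bij[OF assms(1)]]
    Bij_imp_extensional[OF aut_Bij[OF assms(2)]] by (rule extensionalityI[rotated 2])

lemma subgroup_Aut: "subgroup Aut (BijGroup C)"
proof (rule group.subgroupI[OF group_BijGroup])
  show "Aut \<subseteq> carrier (BijGroup C)" using aut_Bij by (simp add: subset_iff)
  have "(\<lambda>z\<in>C. z) \<in> Aut" by (rule AutI) (simp_all add: id_Bij)
  then show "Aut \<noteq> {}" by blast
  show "inv\<^bsub>BijGroup C\<^esub> g \<in> Aut" if g: "g \<in> Aut" for g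
  proof -
    let ?h = "inv\<^bsub>BijGroup C\<^esub> g"
    show ?thesis
    proof (rule AutI)
      show "?h \<in> Bij C" using group.inv_closed[OF group_BijGroup, of g C] aut_Bij[OF g] by simp
      show "(?h z, ?h z') \<in> R i \<longleftrightarrow> (z, z') \<in> R i" if "i \<in> I" "z \<in> C" "z' \<in> C" for i z z'
        using aut_R[OF g that(1), of "?h z" "?h z'"]
          BijGroup_inv_apply[OF aut_Bij[OF g] that(2)] BijGroup_inv_apply[OF aut_Bij[OF g] that(3)]
        by simp
    qed
  qed
  show "g \<otimes>\<^bsub>BijGroup C\<^esub> h \<in> Aut" if g: "g \<in> Aut" and h: "h \<in> Aut" for g h
  proof (rule AutI)
    show "g \<otimes>\<^bsub>BijGroup C\<^esub> h \<in> Bij C"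
      using compose_Bij[OF aut_Bij[OF g] aut_Bij[OF h]] by (simp add: BijGroup_mult aut_Bij g h)
    show "((g \<otimes>\<^bsub>BijGroup C\<^esub> h) z, (g \<otimes>\<^bsub>BijGroup C\<^esub> h) z') \<in> R i \<longleftrightarrow> (z, z') \<in> R i"
      if "i \<in> I" "z \<in> C" "z' \<in> C" for i z z'
      using that aut_in[OF h] aut_R[OF g that(1), of "h z" "h z'"] aut_R[OF h that]
      by (simp add: BijGroup_mult aut_Bij g h compose_def)
  qed
qed

lemma aut_move:
  assumes "g \<in> Aut" "i \<in> I" "x \<in> X i" "z \<in> C"
  shows "move i (lam i (g (move i x z))) (g z) = g (move i x z)"
proof (rule move_eqI)
  show "(g z, g (move i x z)) \<in> R i"
    using aut_R[OF assms(1,2,4)] move_R[OF assms(2-4)] assms by simp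
qed (use assms in simp_all)

lemma aut_lam_other:
  assumes "g \<in> Aut" "i \<in> I" "j \<in> I" "i \<noteq> j" "x \<in> X j" "z \<in> C"
  shows "lam i (g (move j x z)) = lam i (g z)"
proof (rule lam_adjacent)
  show "(g z, g (move j x z)) \<in> R j"
    using aut_R[OF assms(1,3,6)] move_R[OF assms(3,5,6)] assms by simp
qed (use assms in simp_all)

text \<open>
The local action at the \<open>i\<close>-panel of \<open>z\<close>, written without the inverse of the colouring.
\<close>

definition loc :: "'i \<Rightarrow> ('c \<Rightarrow> 'c) \<Rightarrow> 'c \<Rightarrow> 'x \<Rightarrow> 'x" where
  "loc i g z = (\<lambda>x\<in>X i. lam i (g (move i x z)))"

lemma aut_move_loc:
  "g \<in> Aut \<Longrightarrow> i \<in> I \<Longrightarrow> x \<in> X i \<Longrightarrow> z \<in> C \<Longrightarrow> g (move i x z) = move i (loc i g z x) (g z)"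
  unfolding loc_def by (subst aut_move[symmetric]) simp_all

lemma local_action_eq_loc:
  assumes "i \<in> I" "z \<in> C"
  shows "local_action X lam i g (R i `` {z}) = loc i g z"
proof -
  have "inv_into (R i `` {z}) (lam i) x = move i x z" if "x \<in> X i" for x
    using lam_bij[OF assms] move_R[OF assms(1) that assms(2)] lam_move[OF assms(1) that assms(2)]
    by (intro inv_into_f_eq) (auto simp: bij_betw_def)
  then show ?thesis by (auto simp: local_action_def loc_def)
qed

lemma loc_in: "g \<in> Aut \<Longrightarrow> i \<in> I \<Longrightarrow> x \<in> X i \<Longrightarrow> z \<in> C \<Longrightarrow> loc i g z x \<in> X i"
  unfolding loc_def by (simp add: lam_in[OF _ aut_in])

lemma loc_compose:
  assumes "g \<in> Aut" "h \<in> Aut" "i \<in> I" "z \<in> C"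
  shows "loc i (g \<otimes>\<^bsub>BijGroup C\<^esub> h) z = compose (X i) (loc i g (h z)) (loc i h z)"
proof -
  have "lam i (g (h (move i x z))) = lam i (g (move i (loc i h z x) (h z)))" if "x \<in> X i" for x
    using aut_move_loc[of h i x z] assms that by simp
  moreover have "loc i h z x \<in> X i" if "x \<in> X i" for x using loc_in assms that by blast
  ultimately show ?thesis
    using assms by (auto simp: loc_def compose_def BijGroup_mult aut_Bij)
qed

lemma loc_id: "i \<in> I \<Longrightarrow> z \<in> C \<Longrightarrow> loc i (\<lambda>z\<in>C. z) z = (\<lambda>x\<in>X i. x)"
  by (simp add: loc_def restrict_def fun_eq_iff)

lemma aut_inv: "g \<in> Aut \<Longrightarrow> inv\<^bsub>BijGroup C\<^esub> g \<in> Aut"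
  by (rule subgroup.m_inv_closed[OF subgroup_Aut])

lemma aut_inv_apply:
  assumes "g \<in> Aut" "z \<in> C"
  shows "(inv\<^bsub>BijGroup C\<^esub> g) (g z) = z" "g ((inv\<^bsub>BijGroup C\<^esub> g) z) = z"
  using BijGroup_inv_apply[OF aut_Bij[OF assms(1)] assms(2)] by simp_all

lemma loc_inv:
  assumes "g \<in> Aut" "i \<in> I" "z \<in> C"
  shows "compose (X i) (loc i g ((inv\<^bsub>BijGroup C\<^esub> g) z)) (loc i (inv\<^bsub>BijGroup C\<^esub> g) z) = (\<lambda>x\<in>X i. x)"
    and "compose (X i) (loc i (inv\<^bsub>BijGroup C\<^esub> g) (g z)) (loc i g z) = (\<lambda>x\<in>X i. x)"
proof -
  have "g \<in> carrier (BijGroup C)" using aut_Bij[OF assms(1)] by simp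
  note inv = group.r_inv[OF group_BijGroup this] group.l_inv[OF group_BijGroup this]
  show "compose (X i) (loc i g ((inv\<^bsub>BijGroup C\<^esub> g) z)) (loc i (inv\<^bsub>BijGroup C\<^esub> g) z) = (\<lambda>x\<in>X i. x)"
    unfolding loc_compose[OF assms(1) aut_inv[OF assms(1)] assms(2,3), symmetric] inv
    using loc_id[OF assms(2,3)] by simp
  show "compose (X i) (loc i (inv\<^bsub>BijGroup C\<^esub> g) (g z)) (loc i g z) = (\<lambda>x\<in>X i. x)"
    unfolding loc_compose[OF aut_inv[OF assms(1)] assms(1,2,3), symmetric] inv
    using loc_id[OF assms(2,3)] by simp
qed

lemma loc_Bij:
  assumes "g \<in> Aut" "i \<in> I" "z \<in> C"
  shows "loc i g z \<in> Bij (X i)"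
proof -
  let ?g = "inv\<^bsub>BijGroup C\<^esub> g"
  have g: "?g \<in> Aut" "g z \<in> C" "?g (g z) = z" using assms by (simp_all add: aut_inv aut_in aut_inv_apply)
  have "loc i g z (loc i ?g (g z) x) = x" "loc i ?g (g z) (loc i g z x) = x" if "x \<in> X i" for x
    using fun_cong[OF loc_inv(1)[OF assms(1,2) g(2)], of x]
      fun_cong[OF loc_inv(2)[OF assms], of x] g(3) that by (simp_all add: compose_eq)
  then have "bij_betw (loc i g z) (X i) (X i)"
    using loc_in[OF assms(1,2) _ assms(3)] loc_in[OF g(1) assms(2) _ g(2)]
    by (intro bij_betwI[where g = "loc i ?g (g z)"]) auto
  then show ?thesis by (simp add: Bij_def loc_def)
qed

lemma aut_same_colours_eq:
  assumes g: "g \<in> Aut" and h: "h \<in> Aut" and c: "c \<in> C" "g c = h c"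
    and loc: "\<And>i z. i \<in> I \<Longrightarrow> z \<in> C \<Longrightarrow> loc i g z = loc i h z"
  shows "g = h"
proof (rule aut_eqI[OF g h])
  fix z assume "z \<in> C"
  with c(1) show "g z = h z"
    by (induction rule: chamber_induct) (auto simp: c aut_move_loc g h loc)
qed

text \<open>
The states to be transported are the images of chambers: when \<open>z\<close> moves to colour \<open>x\<close> of type \<open>i\<close>, its
image moves to colour \<open>\<sigma> i z x\<close>. The invariant says that colours are related by \<open>\<sigma>\<close>, and
the three coherence conditions are what its preservation and the commutation of moves demand.
The resulting map sends proper galleries to proper galleries of the same type, whence injectivity;
it is onto because its image is closed under moves.
\<close>

theorem automorphism_exists:
  assumes c: "c \<in> C" and d: "d \<in> C"
    and start: "\<And>i. i \<in> I \<Longrightarrow> lam i d = \<sigma> i c (lam i c)"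
    and bij: "\<And>i z. \<lbrakk>i \<in> I; z \<in> C\<rbrakk> \<Longrightarrow> \<sigma> i z \<in> Bij (X i)"
    and same_panel: "\<And>i z x. \<lbrakk>i \<in> I; z \<in> C; x \<in> X i\<rbrakk> \<Longrightarrow> \<sigma> i (move i x z) = \<sigma> i z"
    and parallel: "\<And>i j z x. \<lbrakk>commuting I M i j; z \<in> C; x \<in> X j\<rbrakk> \<Longrightarrow> \<sigma> i (move j x z) = \<sigma> i z"
    and compatible: "\<And>i j z x. \<lbrakk>i \<in> I; j \<in> I; i \<noteq> j; z \<in> C; x \<in> X j\<rbrakk> \<Longrightarrow>
      \<sigma> i (move j x z) (lam i z) = \<sigma> i z (lam i z)"
  obtains g where "g \<in> Aut" "g c = d" "\<And>i z. \<lbrakk>i \<in> I; z \<in> C\<rbrakk> \<Longrightarrow> loc i g z = \<sigma> i z"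
proof -
  let ?Inv = "\<lambda>z m. m \<in> C \<and> (\<forall>i\<in>I. lam i m = \<sigma> i z (lam i z))"
  have sX: "\<sigma> i z x \<in> X i" if "i \<in> I" "z \<in> C" "x \<in> X i" for i z x
    by (rule BijGroup_inv_apply(4)[OF bij[OF that(1,2)] that(3)])
  interpret T: colour_transport I M C R \<delta> X lam "\<lambda>i x z m. move i (\<sigma> i z x) m" ?Inv
  proof unfold_locales
    fix z i x m assume a: "z \<in> C" "i \<in> I" "x \<in> X i" "?Inv z m"
    have "lam j (move i (\<sigma> i z x) m) = \<sigma> j (move i x z) (lam j (move i x z))" if "j \<in> I" for j
      using a that compatible[of j i z x] same_panel[of i z x] sX[of i z x] by (cases "j = i") auto
    then show "?Inv (move i x z) (move i (\<sigma> i z x) m)" using a sX by simp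
  next
    fix z i m assume "z \<in> C" "i \<in> I" "?Inv z m"
    then show "move i (\<sigma> i z (lam i z)) m = m" using move_stay[of i m] by metis
  next
    fix z i x y m assume "z \<in> C" "i \<in> I" "x \<in> X i" "y \<in> X i" "?Inv z m"
    then show "move i (\<sigma> i (move i x z) y) (move i (\<sigma> i z x) m) = move i (\<sigma> i z y) m"
      by (simp add: same_panel sX)
  next
    fix z i j x y m
    assume a: "z \<in> C" "commuting I M i j" "x \<in> X i" "y \<in> X j" "?Inv z m"
    then have "commuting I M j i" "i \<in> I" "j \<in> I" using cm_sym[OF a(2)] by (auto simp: commuting_def)
    then show "move j (\<sigma> j (move i x z) y) (move i (\<sigma> i z x) m) =
        move i (\<sigma> i (move j y z) x) (move j (\<sigma> j z y) m)"
      using a move_commute[OF a(2)] by (simp add: parallel sX)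
  qed
  have "?Inv c d" using d start by simp
  from T.transport[OF c this] obtain h where hc: "h c = d" and h: "\<And>z. z \<in> C \<Longrightarrow> ?Inv z (h z)"
    and hm: "\<And>z i x. \<lbrakk>z \<in> C; i \<in> I; x \<in> X i\<rbrakk> \<Longrightarrow> h (move i x z) = move i (\<sigma> i z x) (h z)"
    by (elim exE conjE) simp
  have hC: "h z \<in> C" if "z \<in> C" for z using h that by blast
  have adj: "(h z, h z') \<in> R i" if "i \<in> I" "(z, z') \<in> R i" for i z z'
  proof -
    have "z \<in> C" "z' \<in> C" "move i (lam i z') z = z'" using that R_in move_eqI by blast+
    then show ?thesis using that hm[of z i "lam i z'"] lam_in sX hC move_R by metis
  qed
  have proper: "h z \<noteq> h z'" if z: "i \<in> I" "(z, z') \<in> R i" "z \<noteq> z'" for i z z'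
  proof
    assume eq: "h z = h z'"
    have zC: "z \<in> C" "z' \<in> C" "move i (lam i z') z = z'" using z R_in move_eqI by blast+
    then have "\<sigma> i z' = \<sigma> i z" using same_panel[of i z "lam i z'"] lam_in z by metis
    then have "\<sigma> i z (lam i z) = \<sigma> i z (lam i z')" using h zC z eq by metis
    then have "lam i z = lam i z'"
      using bij[OF z(1) zC(1)] lam_in zC z by (auto simp: Bij_def bij_betw_def dest: inj_onD)
    then show False using zC z move_stay by metis
  qed
  have joined: "joined w (h z) (h z')" if "w \<in> lists I" "joined w z z'" for w z z'
    using that
  proof (induction w arbitrary: z)
    case (Cons i w)
    then obtain z'' where "z \<in> C" "(z, z'') \<in> R i" "z \<noteq> z''" "joined w z'' z'" "i \<in> I" by auto
    then show ?case using Cons adj proper hC by (auto intro!: exI[of _ "h z''"])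
  qed (auto intro: hC)
  have inj: "z = z'" if "z \<in> C" "z' \<in> C" "h z = h z'" for z z'
  proof -
    obtain w where w: "coxeter_reduced I M w" "joined w z z'" using reduced_gallery \<open>z \<in> C\<close> \<open>z' \<in> C\<close> .
    then have "joined w (h z) (h z')" using joined by (simp add: coxeter_reduced_def)
    then have "w = []" using reduced_closed_gallery w that by metis
    then show ?thesis using w by simp
  qed
  have preimage: "\<exists>x\<in>X i. h (move i x z) = move i y (h z)" if "i \<in> I" "z \<in> C" "y \<in> X i" for i z y
  proof -
    have "y \<in> \<sigma> i z ` X i" using bij[OF that(1,2)] that(3) by (auto simp: Bij_def bij_betw_def)
    then show ?thesis using hm that by auto
  qed
  have surj: "\<exists>z\<in>C. h z = z'" if "z' \<in> C" for z'
    using d that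
  proof (induction rule: chamber_induct)
    case base
    then show ?case using hc c by blast
  next
    case (move z' i y)
    then obtain z where "z \<in> C" "h z = z'" by blast
    then show ?case using preimage[of i z y] move by auto
  qed
  have "bij_betw h C C"
    unfolding bij_betw_def inj_on_def using inj surj hC by blast
  moreover have "(z, z') \<in> R i" if z: "i \<in> I" "z \<in> C" "z' \<in> C" "(h z, h z') \<in> R i" for i z z'
  proof -
    have "move i (lam i (h z')) (h z) = h z'" using move_eqI z by blast
    then obtain x where "x \<in> X i" "h (move i x z) = h z'"
      using preimage[of i z "lam i (h z')"] lam_in hC z by metis
    then have "move i x z = z'" using inj z by simp
    then show ?thesis using move_R \<open>x \<in> X i\<close> z by blast
  qed
  ultimately have aut: "restrict h C \<in> Aut"
    using adj by (intro AutI) (auto simp: Bij_def)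
  have "loc i (restrict h C) z = \<sigma> i z" if z: "i \<in> I" "z \<in> C" for i z
  proof (rule extensionalityI)
    show "loc i (restrict h C) z \<in> extensional (X i)" by (simp add: loc_def)
    show "\<sigma> i z \<in> extensional (X i)" using bij z Bij_imp_extensional by blast
    show "loc i (restrict h C) z x = \<sigma> i z x" if "x \<in> X i" for x
      using z that hm sX hC by (simp add: loc_def)
  qed
  then show ?thesis using that[OF aut] hc c by simp
qed

end

locale coloured_universal_group = coloured_building I M C R \<delta> X lam
  for I :: "'i set" and M :: "'i \<Rightarrow> 'i \<Rightarrow> enat" and C :: "'c set" and R :: "'i \<Rightarrow> ('c \<times> 'c) set"
    and \<delta> :: "'c \<Rightarrow> 'c \<Rightarrow> 'i list set" and X :: "'i \<Rightarrow> 'x set" and lam :: "'i \<Rightarrow> 'c \<Rightarrow> 'x" +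
  fixes F :: "'i \<Rightarrow> ('x \<Rightarrow> 'x) set"
  assumes subgroup_F: "i \<in> I \<Longrightarrow> subgroup (F i) (BijGroup (X i))"
begin

abbreviation U :: "('c \<Rightarrow> 'c) set" where
  "U \<equiv> universal_group I C R X lam F"

lemma U_iff: "g \<in> U \<longleftrightarrow> g \<in> Aut \<and> (\<forall>i\<in>I. \<forall>z\<in>C. loc i g z \<in> F i)"
  unfolding universal_group_def panels_def quotient_def
  by (auto simp: local_action_eq_loc)

lemma U_Aut: "g \<in> U \<Longrightarrow> g \<in> Aut"
  by (simp add: U_iff)

lemma F_Bij: "i \<in> I \<Longrightarrow> f \<in> F i \<Longrightarrow> f \<in> Bij (X i)"
  using subgroup.subset[OF subgroup_F] by auto

lemma F_id: "i \<in> I \<Longrightarrow> (\<lambda>x\<in>X i. x) \<in> F i"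
  using subgroup.one_closed[OF subgroup_F] by auto

lemma subgroup_U: "subgroup U (BijGroup C)"
proof (rule group.subgroupI[OF group_BijGroup])
  show "U \<subseteq> carrier (BijGroup C)" using aut_Bij U_Aut by auto
  have "(\<lambda>z\<in>C. z) \<in> U"
    using subgroup.one_closed[OF subgroup_Aut] by (simp add: U_iff loc_id F_id)
  then show "U \<noteq> {}" by blast
  show "g \<otimes>\<^bsub>BijGroup C\<^esub> h \<in> U" if "g \<in> U" "h \<in> U" for g h
  proof -
    have gh: "g \<in> Aut" "h \<in> Aut" using that U_Aut by auto
    have "loc i (g \<otimes>\<^bsub>BijGroup C\<^esub> h) z \<in> F i" if i: "i \<in> I" "z \<in> C" for i z
    proof -
      have "loc i g (h z) \<in> F i" "loc i h z \<in> F i" using \<open>g \<in> U\<close> \<open>h \<in> U\<close> i aut_in[OF gh(2)] by (simp_all add: U_iff)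
      then show ?thesis
        using subgroup.m_closed[OF subgroup_F[OF i(1)]] loc_compose[OF gh i] F_Bij[OF i(1)]
        by (metis BijGroup_mult)
    qed
    then show ?thesis using subgroup.m_closed[OF subgroup_Aut gh] by (simp add: U_iff)
  qed
  show "inv\<^bsub>BijGroup C\<^esub> g \<in> U" if "g \<in> U" for g
  proof -
    have g: "g \<in> Aut" using that U_Aut by auto
    have "loc i (inv\<^bsub>BijGroup C\<^esub> g) z \<in> F i" if i: "i \<in> I" "z \<in> C" for i z
    proof -
      let ?f = "loc i g ((inv\<^bsub>BijGroup C\<^esub> g) z)"
      have f: "?f \<in> F i" using \<open>g \<in> U\<close> i aut_in[OF aut_inv[OF g]] by (simp add: U_iff)
      have k: "loc i (inv\<^bsub>BijGroup C\<^esub> g) z \<in> Bij (X i)" using loc_Bij aut_inv g i by blast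
      have "?f \<otimes>\<^bsub>BijGroup (X i)\<^esub> loc i (inv\<^bsub>BijGroup C\<^esub> g) z = \<one>\<^bsub>BijGroup (X i)\<^esub>"
        using loc_inv(1)[OF g i] F_Bij[OF i(1) f] k by (simp add: BijGroup_mult)
      then have "loc i (inv\<^bsub>BijGroup C\<^esub> g) z \<otimes>\<^bsub>BijGroup (X i)\<^esub> ?f = \<one>\<^bsub>BijGroup (X i)\<^esub>"
        by (rule group.inv_comm[OF group_BijGroup]) (use k F_Bij[OF i(1) f] in simp_all)
      then have "inv\<^bsub>BijGroup (X i)\<^esub> ?f = loc i (inv\<^bsub>BijGroup C\<^esub> g) z"
        by (rule group.inv_equality[OF group_BijGroup]) (use k F_Bij[OF i(1) f] in simp_all)
      then show ?thesis using subgroup.m_inv_closed[OF subgroup_F[OF i(1)] f] by simp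
    qed
    then show ?thesis using aut_inv[OF g] by (simp add: U_iff)
  qed
qed

end

section \<open>Elements of the universal group supported far away\<close>

context coloured_building
begin

lemma another_colour:
  assumes "i \<in> I" "z \<in> C"
  shows "\<exists>y\<in>X i. y \<noteq> x"
proof -
  obtain c d where cd: "c \<in> R i `` {z}" "d \<in> R i `` {z}" "c \<noteq> d"
    using building panel[OF assms] assms(1) unfolding building_def by meson
  then have "lam i c \<noteq> lam i d" "lam i c \<in> X i" "lam i d \<in> X i"
    using lam_bij[OF assms] by (auto simp: bij_betw_def dest: inj_onD)
  then show ?thesis by metis
qed

text \<open>
The number counts the moves of a path from \<open>a\<close>, including those that do nothing.
\<close>

inductive reaches :: "'c \<Rightarrow> nat \<Rightarrow> 'c \<Rightarrow> bool" for a where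
  reaches_refl: "reaches a 0 a"
| reaches_move: "reaches a n z \<Longrightarrow> i \<in> I \<Longrightarrow> x \<in> X i \<Longrightarrow> reaches a (Suc n) (move i x z)"

lemma reaches_in: "reaches a n z \<Longrightarrow> a \<in> C \<Longrightarrow> z \<in> C"
  by (induction rule: reaches.induct) auto

lemma reaches_ex:
  assumes "a \<in> C" "z \<in> C"
  shows "\<exists>n. reaches a n z"
  using assms by (induction rule: chamber_induct) (auto intro: reaches_refl reaches_move)

end

text \<open>
Fix two types \<open>i\<close> and \<open>j\<close> that generate an infinite dihedral group. Forgetting the moves of
all other types retracts the building onto the tree formed by the residue of type \<open>{i, j}\<close>
at \<open>a\<close>. A chamber of this residue is recorded as a stack: the types and colours of the proper moves that
lead to it from \<open>a\<close>, with alternating types and the latest move on top. The chambers that retract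
beyond a given one form regions of the building that are far from \<open>a\<close>.
\<close>

locale stack_machine = coloured_building I M C R \<delta> X lam
  for I :: "'i set" and M :: "'i \<Rightarrow> 'i \<Rightarrow> enat" and C :: "'c set" and R :: "'i \<Rightarrow> ('c \<times> 'c) set"
    and \<delta> :: "'c \<Rightarrow> 'c \<Rightarrow> 'i list set" and X :: "'i \<Rightarrow> 'x set" and lam :: "'i \<Rightarrow> 'c \<Rightarrow> 'x" +
  fixes i j :: 'i and a :: 'c
  assumes i: "i \<in> I" and j: "j \<in> I" and ij: "i \<noteq> j" and not_commuting: "\<not> commuting I M i j"
    and a: "a \<in> C"
begin

text \<open>
The \<open>k\<close>-colour of the chamber that a stack describes; the bottom of the stack stands for \<open>a\<close>.
\<close>

fun cur :: "'i \<Rightarrow> ('i \<times> 'x) list \<Rightarrow> 'x" where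
  "cur k [] = lam k a"
| "cur k ((l, y) # m) = (if l = k then y else cur k m)"

fun strip :: "'i \<Rightarrow> ('i \<times> 'x) list \<Rightarrow> ('i \<times> 'x) list" where
  "strip k [] = []"
| "strip k ((l, y) # m) = (if l = k then m else (l, y) # m)"

text \<open>
A move of type \<open>k\<close> replaces a \<open>k\<close>-entry on top of the stack. If it returns to the \<open>k\<close>-colour held
below that entry, the entry disappears.
\<close>

definition put :: "'i \<Rightarrow> 'x \<Rightarrow> ('i \<times> 'x) list \<Rightarrow> ('i \<times> 'x) list" where
  "put k y m = (if y = cur k (strip k m) then strip k m else (k, y) # strip k m)"

fun reduced :: "('i \<times> 'x) list \<Rightarrow> bool" where
  "reduced [] \<longleftrightarrow> True"
| "reduced ((l, y) # m) \<longleftrightarrow> y \<noteq> cur l m \<and> strip l m = m \<and> reduced m"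

lemma reduced_strip: "reduced m \<Longrightarrow> reduced (strip k m)"
  by (cases m) auto

lemma strip_strip: "reduced m \<Longrightarrow> strip k (strip k m) = strip k m"
  by (cases m) auto

lemma cur_strip: "l \<noteq> k \<Longrightarrow> cur l (strip k m) = cur l m"
  by (cases "(k, m)" rule: strip.cases) auto

lemma reduced_put: "reduced m \<Longrightarrow> reduced (put k y m)"
  by (auto simp: put_def reduced_strip strip_strip)

lemma cur_put: "cur k (put k y m) = y" "l \<noteq> k \<Longrightarrow> cur l (put k y m) = cur l m"
  by (auto simp: put_def cur_strip)

lemma put_cur: "reduced m \<Longrightarrow> put k (cur k m) m = m"
  by (cases "(k, m)" rule: strip.cases) (auto simp: put_def)

lemma put_put: "reduced m \<Longrightarrow> put k y (put k x m) = put k y m"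
  using strip_strip[of m k] by (auto simp: put_def)

definition trace_step :: "'i \<Rightarrow> 'x \<Rightarrow> ('i \<times> 'x) list \<Rightarrow> ('i \<times> 'x) list" where
  "trace_step k y m = (if k = i \<or> k = j then put k y m else m)"

definition tracks :: "'c \<Rightarrow> ('i \<times> 'x) list \<Rightarrow> bool" where
  "tracks z m \<longleftrightarrow> reduced m \<and> cur i m = lam i z \<and> cur j m = lam j z"

text \<open>
Two commuting types cannot both be among \<open>i\<close> and \<open>j\<close>, so at least one of the two operations
on stacks is trivial and the interchange law holds.
\<close>

lemma stack_ex:
  "\<exists>h. h a = [] \<and> (\<forall>z\<in>C. tracks z (h z)) \<and>
    (\<forall>z\<in>C. \<forall>k\<in>I. \<forall>y\<in>X k. h (move k y z) = trace_step k y (h z))"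
proof -
  interpret T: colour_transport I M C R \<delta> X lam "\<lambda>k y z m. trace_step k y m" tracks
  proof unfold_locales
    fix z k y m assume "z \<in> C" "k \<in> I" "y \<in> X k" "tracks z m"
    then show "tracks (move k y z) (trace_step k y m)"
      using i j ij by (auto simp: tracks_def trace_step_def reduced_put cur_put)
  next
    fix z k m assume "tracks z m"
    then show "trace_step k (lam k z) m = m"
      using put_cur[of m k] by (auto simp: tracks_def trace_step_def)
  next
    fix z k x y m assume "tracks z m"
    then show "trace_step k y (trace_step k x m) = trace_step k y m"
      by (simp add: tracks_def trace_step_def put_put)
  next
    fix z k l x y m assume "commuting I M k l"
    then have "\<not> ((k = i \<or> k = j) \<and> (l = i \<or> l = j))"
      using not_commuting cm_sym[of k l] cm_irrefl by metis
    then show "trace_step l y (trace_step k x m) = trace_step k x (trace_step l y m)"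
      by (auto simp: trace_step_def)
  qed
  show ?thesis by (rule T.transport[OF a]) (simp add: tracks_def)
qed

definition stack :: "'c \<Rightarrow> ('i \<times> 'x) list" where
  "stack = (SOME h. h a = [] \<and> (\<forall>z\<in>C. tracks z (h z)) \<and>
    (\<forall>z\<in>C. \<forall>k\<in>I. \<forall>y\<in>X k. h (move k y z) = trace_step k y (h z)))"

lemma stack_start: "stack a = []"
  and stack_tracks: "z \<in> C \<Longrightarrow> tracks z (stack z)"
  and stack_move: "z \<in> C \<Longrightarrow> k \<in> I \<Longrightarrow> y \<in> X k \<Longrightarrow> stack (move k y z) = trace_step k y (stack z)"
  using someI_ex[OF stack_ex] unfolding stack_def by blast+

lemma length_stack: "reaches a n z \<Longrightarrow> length (stack z) \<le> n"
proof (induction rule: reaches.induct)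
  case (reaches_move n z k x)
  have strip: "length (strip k m) \<le> length m" for m
    by (cases "(k, m)" rule: strip.cases) auto
  have "length (trace_step k x m) \<le> Suc (length m)" for m
    using strip[of m] by (auto simp: trace_step_def put_def)
  then show ?case
    using reaches_move stack_move[of z k x] reaches_in[OF _ a]
    by (metis le_trans Suc_le_mono)
qed (simp add: stack_start)

lemma push:
  assumes z: "reaches a n z" "length (stack z) = n" and k: "k = i \<or> k = j"
    and top: "strip k (stack z) = stack z" and y: "y \<in> X k" "y \<noteq> lam k z"
  shows "reaches a (Suc n) (move k y z)" "stack (move k y z) = (k, y) # stack z"
    "length (stack (move k y z)) = Suc n"
proof -
  have kI: "k \<in> I" using k i j by auto
  then show "reaches a (Suc n) (move k y z)" using z y reaches_move by blast
  have "cur k (stack z) = lam k z"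
    using stack_tracks[OF reaches_in[OF z(1) a]] k by (auto simp: tracks_def)
  then show "stack (move k y z) = (k, y) # stack z"
    using stack_move[OF reaches_in[OF z(1) a] kI y(1)] y(2) k top
    by (simp add: trace_step_def put_def)
  then show "length (stack (move k y z)) = Suc n" using z by simp
qed

text \<open>
Moving alternately in types \<open>i\<close> and \<open>j\<close> makes the stack arbitrarily high. Four moves are
used for each round, because the \<open>i\<close>-colour must leave \<open>x\<close> before it can be set to \<open>x\<close> again.
\<close>

lemma deep_chamber:
  assumes x: "x \<in> X i"
  shows "\<exists>n e y s. n \<ge> N \<and> reaches a n e \<and> length (stack e) = n \<and> stack e = (j, y) # s \<and> lam i e = x"
proof (induction N)
  case 0
  have push_j: ?case if z: "reaches a n z" "length (stack z) = n" "strip j (stack z) = stack z" "lam i z = x" for n z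
  proof -
    have zC: "z \<in> C" using reaches_in z a by blast
    obtain y where y: "y \<in> X j" "y \<noteq> lam j z" using another_colour j a by blast
    have "lam i (move j y z) = x" using z(4) zC y i j ij by simp
    then show ?thesis using push[OF z(1,2) _ z(3) y] by blast
  qed
  show ?case
  proof (cases "lam i a = x")
    case True
    then show ?thesis using push_j[OF reaches_refl] by (simp add: stack_start)
  next
    case False
    note p = push[OF reaches_refl, of i x]
    have "lam i (move i x a) = x" using i x a by simp
    then show ?thesis
      using push_j[OF p(1)] p False x ij by (simp add: stack_start)
  qed
next
  case (Suc N)
  then obtain n e y s where e: "n \<ge> N" "reaches a n e" "length (stack e) = n" "stack e = (j, y) # s" "lam i e = x"
    by blast
  have eC: "e \<in> C" using reaches_in e a by blast
  obtain x' where x': "x' \<in> X i" "x' \<noteq> x" using another_colour i a by blast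
  let ?e1 = "move i x' e"
  have e1: "reaches a (Suc n) ?e1" "length (stack ?e1) = Suc n" "stack ?e1 = (i, x') # stack e" "?e1 \<in> C"
    using push[OF e(2,3), of i x'] e x' ij i eC by auto
  obtain y1 where y1: "y1 \<in> X j" "y1 \<noteq> lam j ?e1" using another_colour j a by blast
  let ?e2 = "move j y1 ?e1"
  have e2: "reaches a (Suc (Suc n)) ?e2" "length (stack ?e2) = Suc (Suc n)" "stack ?e2 = (j, y1) # stack ?e1" "?e2 \<in> C"
    using push[OF e1(1,2), of j y1] e1 y1 ij j by auto
  have "lam i ?e2 = x'" using i j ij e1 y1 x' eC by simp
  then have x2: "x \<noteq> lam i ?e2" using x' by simp
  let ?e3 = "move i x ?e2"
  have e3: "reaches a (Suc (Suc (Suc n))) ?e3" "length (stack ?e3) = Suc (Suc (Suc n))" "stack ?e3 = (i, x) # stack ?e2" "?e3 \<in> C"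
    using push[OF e2(1,2), of i x] e2 x x2 ij i by auto
  obtain y3 where y3: "y3 \<in> X j" "y3 \<noteq> lam j ?e3" using another_colour j a by blast
  let ?e4 = "move j y3 ?e3"
  have e4: "reaches a (Suc (Suc (Suc (Suc n)))) ?e4" "length (stack ?e4) = Suc (Suc (Suc (Suc n)))"
      "stack ?e4 = (j, y3) # stack ?e3"
    using push[OF e3(1,2), of j y3] e3 y3 ij j by auto
  have "lam i ?e4 = lam i ?e3" using i j ij e3 y3 by (intro lam_move_other) auto
  then have "lam i ?e4 = x" using i e2 x by simp
  then show ?case using e4 e(1) by (intro exI[of _ "Suc (Suc (Suc (Suc n)))"]) auto
qed

text \<open>
The chambers whose retraction lies at or beyond the chamber with stack \<open>s\<close>.
\<close>

definition extends :: "('i \<times> 'x) list \<Rightarrow> 'c \<Rightarrow> bool" where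
  "extends s z \<longleftrightarrow> (\<exists>p. stack z = p @ s)"

lemma put_extends:
  assumes "p \<noteq> [] \<or> strip k s = s"
  shows "\<exists>q. put k y (p @ s) = q @ s"
proof -
  have "\<exists>q. strip k (p @ s) = q @ s"
  proof (cases p)
    case Nil
    then show ?thesis using assms by simp
  next
    case (Cons l p')
    then have "strip k (p @ s) = p' @ s \<or> strip k (p @ s) = p @ s" by (cases l) simp
    then show ?thesis by blast
  qed
  then obtain q where "strip k (p @ s) = q @ s" ..
  then have "put k y (p @ s) = q @ s \<or> put k y (p @ s) = ((k, y) # q) @ s" by (simp add: put_def)
  then show ?thesis by blast
qed

lemma move_back:
  assumes "z \<in> C" "k \<in> I" "y \<in> X k"
  shows "z = move k (lam k z) (move k y z)"
  using assms lam_in by simp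

lemma extends_move:
  assumes z: "z \<in> C" "k \<in> I" "y \<in> X k" and k: "k = j \<Longrightarrow> stack z \<noteq> (j, y0) # s"
    and ext: "extends ((j, y0) # s) z"
  shows "extends ((j, y0) # s) (move k y z)"
proof -
  obtain p where p: "stack z = p @ (j, y0) # s" using ext by (auto simp: extends_def)
  show ?thesis
  proof (cases "k = i \<or> k = j")
    case True
    then have "p \<noteq> [] \<or> strip k ((j, y0) # s) = (j, y0) # s" using k p ij by auto
    then show ?thesis
      using put_extends stack_move[OF z] p True by (auto simp: extends_def trace_step_def)
  next
    case False
    then show ?thesis using stack_move[OF z] ext by (simp add: extends_def trace_step_def)
  qed
qed

lemma extends_move_iff:
  assumes z: "z \<in> C" "k \<in> I" "y \<in> X k" and k: "k \<noteq> j"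
  shows "extends ((j, y0) # s) (move k y z) \<longleftrightarrow> extends ((j, y0) # s) z"
  using extends_move[OF z] extends_move[of "move k y z" k "lam k z"] move_back[OF z] z k lam_in
  by (metis move_in)

text \<open>
Only a \<open>j\<close>-move can leave or enter the region, at a chamber with stack exactly \<open>(j, y0) # s\<close>, and
there the \<open>i\<close>-colour is the one that the stack prescribes. So a permutation of \<open>i\<close>-colours that fixes
this colour can be applied inside the region and the identity outside.
\<close>

lemma extends_boundary:
  assumes z: "z \<in> C" "y \<in> X j"
    and cross: "extends ((j, y0) # s) (move j y z) \<noteq> extends ((j, y0) # s) z"
  shows "lam i z = cur i ((j, y0) # s)"
proof -
  let ?z = "move j y z"
  have "stack z = (j, y0) # s \<or> stack ?z = (j, y0) # s"
    using cross extends_move[of z j y y0 s] extends_move[of ?z j "lam j z" y0 s]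
      move_back[of z j y] z j lam_in by (metis move_in)
  moreover have "lam i ?z = lam i z" using z i j ij by simp
  moreover have "cur i (stack z) = lam i z" "cur i (stack ?z) = lam i ?z"
    using stack_tracks z j by (simp_all add: tracks_def)
  ultimately show ?thesis by metis
qed

end

context coloured_universal_group
begin

text \<open>
Choose a region whose stack is at least as high as the number of moves that reach each chamber of \<open>A\<close>,
with \<open>i\<close>-colour \<open>x\<close> at its boundary, and act by \<open>f\<close> on the \<open>i\<close>-colours inside it. Short paths from \<open>a\<close>
stay outside the region, so \<open>A\<close> is fixed, as is the chamber \<open>e\<close> at which the region begins.
\<close>

lemma remote_element:
  assumes ij: "i \<in> I" "j \<in> I" "i \<noteq> j" "\<not> commuting I M i j" and x: "x \<in> X i"
    and A: "finite A" "A \<subseteq> C"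
  shows "\<exists>e\<in>C. lam i e = x \<and>
    (\<forall>f\<in>F i. f x = x \<longrightarrow> (\<exists>g\<in>U. (\<forall>b\<in>A. g b = b) \<and> g e = e \<and> loc i g e = f))"
proof -
  obtain a where a: "a \<in> C" using building by (auto simp: building_def)
  interpret S: stack_machine I M C R \<delta> X lam i j a
    by unfold_locales (use ij a in auto)
  have "\<exists>N. \<forall>b\<in>A. \<exists>n\<le>N. reaches a n b" using A
  proof (induction rule: finite_induct)
    case (insert b A)
    then obtain N n where "\<forall>b\<in>A. \<exists>n\<le>N. reaches a n b" "reaches a n b"
      using reaches_ex[OF a] by blast
    then have "\<exists>n'\<le>max N n. reaches a n' b'" if "b' \<in> insert b A" for b'
      using that by (metis insert_iff max.cobounded1 max.cobounded2 le_trans)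
    then show ?case by blast
  qed auto
  then obtain N where N: "\<forall>b\<in>A. \<exists>n\<le>N. reaches a n b" by blast
  obtain n e y s where e: "n \<ge> N" "reaches a n e" "length (S.stack e) = n" "S.stack e = (j, y) # s"
      "lam i e = x"
    using S.deep_chamber[OF x] by metis
  have eC: "e \<in> C" using reaches_in e(2) a .
  let ?Q = "S.extends ((j, y) # s)"
  have "S.cur i (S.stack e) = x" using S.stack_tracks[OF eC] e(5) by (simp only: S.tracks_def)
  then have cur: "S.cur i ((j, y) # s) = x" by (simp only: e(4))
  have "\<exists>g\<in>U. (\<forall>b\<in>A. g b = b) \<and> g e = e \<and> loc i g e = f" if f: "f \<in> F i" "f x = x" for f
  proof -
    \<comment> \<open>Act by \<open>f\<close> inside the region only; the region lies behind a wall that \<open>f\<close> respects.\<close>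
    let ?\<sigma> = "\<lambda>k z. if k = i \<and> ?Q z then f else (\<lambda>x\<in>X k. x)"
    have "\<exists>g. g \<in> Aut \<and> g a = a \<and> (\<forall>k\<in>I. \<forall>z\<in>C. loc k g z = ?\<sigma> k z)"
    proof (rule automorphism_exists[OF a a, of ?\<sigma>])
      show "lam k a = ?\<sigma> k a (lam k a)" if "k \<in> I" for k
        using lam_in[OF that a] by (simp add: S.extends_def S.stack_start)
      show "?\<sigma> k z \<in> Bij (X k)" if "k \<in> I" "z \<in> C" for k z
        using F_Bij f that id_Bij by auto
      show "?\<sigma> k (move k x z) = ?\<sigma> k z" if "k \<in> I" "z \<in> C" "x \<in> X k" for k z x
        using S.extends_move_iff[of z k x y s] that ij by auto
      show "?\<sigma> k (move l x z) = ?\<sigma> k z" if "commuting I M k l" "z \<in> C" "x \<in> X l" for k l z x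
        using S.extends_move_iff[of z l x y s] that ij by (auto simp: commuting_def)
      show "?\<sigma> k (move l x' z) (lam k z) = ?\<sigma> k z (lam k z)"
        if "k \<in> I" "l \<in> I" "k \<noteq> l" "z \<in> C" "x' \<in> X l" for k l z x'
      proof (cases "?Q (move l x' z) = ?Q z")
        case True
        then show ?thesis by simp
      next
        case False
        then have "l = j" using S.extends_move_iff[of z l x' y s] that by blast
        then have "lam i z = x" using S.extends_boundary[of z x' y s] False that cur by simp
        then show ?thesis using f x by auto
      qed
    qed blast
    then obtain g where g: "g \<in> Aut" "g a = a" "\<And>k z. \<lbrakk>k \<in> I; z \<in> C\<rbrakk> \<Longrightarrow> loc k g z = ?\<sigma> k z"
      by blast
    have "g \<in> U" using g f F_id by (auto simp: U_iff)
    have fixed: "g z = z" if "reaches a m z" "m \<le> n" for m z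
      using that
    proof (induction rule: reaches.induct)
      case (reaches_move m z k x)
      have z: "z \<in> C" using reaches_in reaches_move a by blast
      have "length (S.stack z) < length ((j, y) # s)"
        using S.length_stack[OF reaches_move(1)] reaches_move e by simp
      then have "\<not> ?Q z" by (auto simp: S.extends_def)
      then show ?case using aut_move_loc[OF g(1)] g(3) z reaches_move by simp
    qed (rule g)
    have "g b = b" if "b \<in> A" for b
      using bspec[OF N that] fixed e(1) le_trans by blast
    moreover have "?Q e" by (simp add: S.extends_def e)
    then have "loc i g e = f" using g(3) ij eC by simp
    ultimately show ?thesis using \<open>g \<in> U\<close> fixed[OF e(2)] by blast
  qed
  then show ?thesis using eC e(5) by blast
qed

text \<open>
By \<open>remote_element\<close> the orbit of \<open>y\<close> under the stabiliser of \<open>x\<close> in \<open>F i\<close> is read off from the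
orbit of one chamber under the pointwise stabiliser of \<open>A\<close>.
\<close>

lemma point_stabilizer_finite_orbits:
  assumes ij: "i \<in> I" "j \<in> I" "i \<noteq> j" "\<not> commuting I M i j" and x: "x \<in> X i" and y: "y \<in> X i"
    and A: "finite A" "A \<subseteq> C"
    and orbits: "\<And>z. z \<in> C \<Longrightarrow> finite {g z | g. g \<in> U \<and> (\<forall>b\<in>A. g b = b)}"
  shows "finite {f y | f. f \<in> F i \<and> f x = x}"
proof -
  obtain e where e: "e \<in> C" and f: "\<And>f. f \<in> F i \<Longrightarrow> f x = x \<Longrightarrow>
      \<exists>g\<in>U. (\<forall>b\<in>A. g b = b) \<and> g e = e \<and> loc i g e = f"
    using remote_element[OF ij x A] by blast
  have "{f y | f. f \<in> F i \<and> f x = x} \<subseteq>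
      lam i ` {g (move i y e) | g. g \<in> U \<and> (\<forall>b\<in>A. g b = b)}"
  proof
    fix v assume "v \<in> {f y | f. f \<in> F i \<and> f x = x}"
    then obtain k where k: "k \<in> F i" "k x = x" "v = k y" by blast
    then obtain g where g: "g \<in> U" "\<forall>b\<in>A. g b = b" "loc i g e = k" using f by blast
    then have "v = lam i (g (move i y e))" using k(3) y by (auto simp: loc_def)
    then show "v \<in> lam i ` {g (move i y e) | g. g \<in> U \<and> (\<forall>b\<in>A. g b = b)}" using g by blast
  qed
  moreover have "finite (lam i ` {g (move i y e) | g. g \<in> U \<and> (\<forall>b\<in>A. g b = b)})"
    using orbits[of "move i y e"] ij y e by simp
  ultimately show ?thesis by (rule finite_subset)
qed

end

section \<open>The permutation topology\<close>

lemma openin_perm_topology_iff: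
  assumes "subgroup G (BijGroup S)"
  shows "openin (perm_topology S G) V \<longleftrightarrow>
    V \<subseteq> G \<and> (\<forall>g\<in>V. \<exists>A. finite A \<and> A \<subseteq> S \<and> {h \<in> G. \<forall>x\<in>A. h x = g x} \<subseteq> V)"
  unfolding openin_perm_topology
proof (intro conj_cong refl ball_cong ex_cong1)
  show "g <#\<^bsub>perm_group S G\<^esub> pointwise_stabilizer G A \<subseteq> V \<longleftrightarrow> {h \<in> G. \<forall>x\<in>A. h x = g x} \<subseteq> V"
    if "V \<subseteq> G" "g \<in> V" "A \<subseteq> S" for g A
    unfolding pointwise_coset_eq[OF assms that(3) subsetD[OF that(1,2)]] ..
qed simp_all

lemma topspace_perm_topology:
  assumes "subgroup G (BijGroup S)"
  shows "topspace (perm_topology S G) = G"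
proof
  show "topspace (perm_topology S G) \<subseteq> G"
    using openin_topspace[of "perm_topology S G"] openin_perm_topology_iff[OF assms] by blast
  have "openin (perm_topology S G) G"
    unfolding openin_perm_topology_iff[OF assms] by (intro conjI ballI exI[of _ "{}"]) auto
  then show "G \<subseteq> topspace (perm_topology S G)" by (rule openin_subset)
qed

lemma closedin_stabilizer:
  assumes "subgroup G (BijGroup S)" "A \<subseteq> S"
  shows "closedin (perm_topology S G) (pointwise_stabilizer G A)"
proof -
  have "\<exists>B. finite B \<and> B \<subseteq> S \<and> {h \<in> G. \<forall>x\<in>B. h x = g x} \<subseteq> G - pointwise_stabilizer G A"
    if g: "g \<in> G - pointwise_stabilizer G A" for g
  proof -
    obtain x where "x \<in> A" "g x \<noteq> x" using g by (auto simp: pointwise_stabilizer_def)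
    then show ?thesis
      using assms(2) by (intro exI[of _ "{x}"]) (auto simp: pointwise_stabilizer_def)
  qed
  then have "openin (perm_topology S G) (G - pointwise_stabilizer G A)"
    unfolding openin_perm_topology_iff[OF assms(1)] by blast
  then show ?thesis
    by (simp add: closedin_def topspace_perm_topology[OF assms(1)] pointwise_stabilizer_def)
qed

lemma locally_compact_perm_group:
  assumes G: "subgroup G (BijGroup S)" and "locally_compact_space (perm_topology S G)"
  obtains A where "finite A" "A \<subseteq> S" "compactin (perm_topology S G) (pointwise_stabilizer G A)"
proof -
  let ?T = "perm_topology S G"
  have "(\<lambda>x\<in>S. x) \<in> G" using subgroup.one_closed[OF G] by simp
  then have "(\<lambda>x\<in>S. x) \<in> topspace ?T" by (simp add: topspace_perm_topology[OF G])
  from assms(2)[unfolded locally_compact_space_def, rule_format, OF this]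
  obtain V K where V: "openin ?T V" "compactin ?T K" "(\<lambda>x\<in>S. x) \<in> V" "V \<subseteq> K" by blast
  from V(1)[unfolded openin_perm_topology_iff[OF G], THEN conjunct2, rule_format, OF V(3)]
  obtain A where A: "finite A" "A \<subseteq> S" "{h \<in> G. \<forall>x\<in>A. h x = (\<lambda>x\<in>S. x) x} \<subseteq> V"
    by (elim exE conjE)
  have "pointwise_stabilizer G A \<subseteq> K"
    using A V(4) by (auto simp: pointwise_stabilizer_def subset_iff)
  then have "compactin ?T (pointwise_stabilizer G A)"
    using closed_compactin[OF V(2) _ closedin_stabilizer[OF G A(2)]] by blast
  then show ?thesis using that A by blast
qed

text \<open>
The orbit map is continuous into the discrete space \<open>S\<close>.
\<close>

lemma compact_orbit_finite:
  assumes G: "subgroup G (BijGroup S)" and K: "compactin (perm_topology S G) K" and x: "x \<in> S"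
  shows "finite ((\<lambda>g. g x) ` K)"
proof -
  have "openin (perm_topology S G) {g \<in> G. g x \<in> V}" for V
    unfolding openin_perm_topology_iff[OF G] using x by (auto intro!: exI[of _ "{x}"])
  then have "continuous_map (perm_topology S G) (discrete_topology UNIV) (\<lambda>g. g x)"
    by (simp add: continuous_map_def topspace_perm_topology[OF G])
  from image_compactin[OF K this] show ?thesis by (simp add: compactin_discrete_topology)
qed

lemma finite_witnesses:
  assumes "finite D" "\<And>d. d \<in> D \<Longrightarrow> \<exists>s\<in>S. P d s"
  obtains E where "finite E" "E \<subseteq> S" "\<forall>d\<in>D. \<exists>s\<in>E. P d s"
proof -
  obtain f where "\<forall>d\<in>D. f d \<in> S \<and> P d (f d)" using assms(2) bchoice[of D "\<lambda>d s. s \<in> S \<and> P d s"] by blast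
  then have "finite (f ` D)" "f ` D \<subseteq> S" "\<forall>d\<in>D. \<exists>s\<in>f ` D. P d s" using assms(1) by auto
  then show ?thesis by (rule that)
qed

lemma finite_orbit_representatives:
  assumes F: "subgroup F (BijGroup S)" and "finite (orbits (perm_group S F) S (\<lambda>g. g))"
  obtains Y where "finite Y" "Y \<subseteq> S" "\<forall>y\<in>S. \<exists>r\<in>Y. \<exists>f\<in>F. f r = y"
proof -
  let ?o = "orbit (perm_group S F) (\<lambda>g. g)"
  have self: "x \<in> ?o x" if "x \<in> S" for x
    using subgroup.one_closed[OF F] that unfolding orbit_def perm_group_def
    by (auto intro!: exI[of _ "\<lambda>x\<in>S. x"])
  have "finite (?o ` S)" using assms(2) by (simp add: orbits_def Setcompr_eq_image)
  then obtain Y where Y: "Y \<subseteq> S" "finite Y" "?o ` S = ?o ` Y" by (metis finite_subset_image subset_refl)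
  have "\<forall>y\<in>S. \<exists>r\<in>Y. \<exists>f\<in>F. f r = y"
  proof
    fix y assume "y \<in> S"
    obtain r where "r \<in> Y" "?o y = ?o r" using Y(3) \<open>y \<in> S\<close> by blast
    then show "\<exists>r\<in>Y. \<exists>f\<in>F. f r = y"
      using self[OF \<open>y \<in> S\<close>] by (auto simp: orbit_def perm_group_def)
  qed
  then show ?thesis by (rule that[OF Y(2,1)])
qed

lemma perm_group_generate:
  assumes G: "subgroup G (BijGroup S)" and K: "K \<subseteq> G"
  shows "subgroup (generate (perm_group S G) K) (BijGroup S)" "generate (perm_group S G) K \<subseteq> G"
    "K \<subseteq> generate (perm_group S G) K"
proof -
  interpret B: group "BijGroup S" by (rule group_BijGroup)
  have eq: "generate (perm_group S G) K = generate (BijGroup S) K"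
    unfolding perm_group_def by (rule B.generate_consistent[OF K G])
  show "subgroup (generate (perm_group S G) K) (BijGroup S)"
    unfolding eq using K subgroup.subset[OF G] by (intro B.generate_is_subgroup) simp
  show "generate (perm_group S G) K \<subseteq> G" unfolding eq by (rule B.generate_subgroup_incl[OF K G])
  show "K \<subseteq> generate (perm_group S G) K" by (auto intro: generate.incl)
qed

section \<open>Uniform recolourings of one type\<close>

context coloured_universal_group
begin

abbreviation mul (infixl "\<cdot>" 70) where "g \<cdot> h \<equiv> g \<otimes>\<^bsub>BijGroup C\<^esub> h"

abbreviation iv where "iv g \<equiv> inv\<^bsub>BijGroup C\<^esub> g"

lemma mul_apply: "g \<in> U \<Longrightarrow> h \<in> U \<Longrightarrow> z \<in> C \<Longrightarrow> (g \<cdot> h) z = g (h z)"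
  by (simp add: BijGroup_mult aut_Bij U_Aut compose_eq)

lemma U_in: "g \<in> U \<Longrightarrow> z \<in> C \<Longrightarrow> g z \<in> C"
  using aut_in U_Aut by blast

lemma U_mul: "g \<in> U \<Longrightarrow> h \<in> U \<Longrightarrow> g \<cdot> h \<in> U"
  by (rule subgroup.m_closed[OF subgroup_U])

lemma U_iv: "g \<in> U \<Longrightarrow> iv g \<in> U"
  by (rule subgroup.m_inv_closed[OF subgroup_U])

lemma iv_apply: "g \<in> U \<Longrightarrow> z \<in> C \<Longrightarrow> g z = z' \<Longrightarrow> iv g z' = z"
  using aut_inv_apply(1) U_Aut by blast

lemma iv_cancel:
  assumes "g \<in> U" "h \<in> U"
  shows "g \<cdot> (iv g \<cdot> h) = h" "iv g \<cdot> (g \<cdot> h) = h"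
proof -
  interpret B: group "BijGroup C" by (rule group_BijGroup)
  have c: "g \<in> carrier (BijGroup C)" "h \<in> carrier (BijGroup C)"
    using assms aut_Bij U_Aut by auto
  show "g \<cdot> (iv g \<cdot> h) = h" "iv g \<cdot> (g \<cdot> h) = h"
    using c by (simp_all only: B.m_assoc[symmetric] B.inv_closed B.r_inv B.l_inv B.l_one)
qed

text \<open>
The constant family of local actions \<open>\<phi>\<close> is trivially coherent.
\<close>

lemma transitive_on_orbit_types:
  assumes b: "b \<in> C" and z: "z \<in> C" and f: "\<And>i. i \<in> I \<Longrightarrow> \<exists>f\<in>F i. f (lam i b) = lam i z"
  shows "\<exists>g\<in>U. g b = z"
proof -
  obtain \<phi> where \<phi>: "\<forall>i\<in>I. \<phi> i \<in> F i \<and> \<phi> i (lam i b) = lam i z"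
    using f bchoice[of I "\<lambda>i f. f \<in> F i \<and> f (lam i b) = lam i z"] by blast
  have "\<exists>g. g \<in> Aut \<and> g b = z \<and> (\<forall>i\<in>I. \<forall>z\<in>C. loc i g z = \<phi> i)"
    by (rule automorphism_exists[OF b z, of "\<lambda>i z. \<phi> i"]) (use \<phi> F_Bij in auto)
  then show ?thesis using \<phi> by (auto simp: U_iff)
qed

text \<open>
The automorphism with local action \<open>f\<close> at all \<open>i\<close>-panels and trivial local action at all others,
normalised so that it preserves the \<open>i\<close>-panel of \<open>b\<close>. With this normalisation it is a
homomorphism in \<open>f\<close>.
\<close>

definition shift :: "'i \<Rightarrow> 'c \<Rightarrow> ('x \<Rightarrow> 'x) \<Rightarrow> 'c \<Rightarrow> 'c" where
  "shift i b f = (SOME g. g \<in> Aut \<and> g b = move i (f (lam i b)) b \<and>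
     (\<forall>k\<in>I. \<forall>z\<in>C. loc k g z = (if k = i then f else (\<lambda>x\<in>X k. x))))"

lemma shift:
  assumes i: "i \<in> I" and b: "b \<in> C" and f: "f \<in> Bij (X i)"
  shows "shift i b f \<in> Aut" "shift i b f b = move i (f (lam i b)) b"
    "\<And>k z. k \<in> I \<Longrightarrow> z \<in> C \<Longrightarrow> loc k (shift i b f) z = (if k = i then f else (\<lambda>x\<in>X k. x))"
proof -
  have fl: "f (lam i b) \<in> X i" using BijGroup_inv_apply(4)[OF f] lam_in[OF i b] by simp
  have "\<exists>g. g \<in> Aut \<and> g b = move i (f (lam i b)) b \<and>
     (\<forall>k\<in>I. \<forall>z\<in>C. loc k g z = (if k = i then f else (\<lambda>x\<in>X k. x)))"
    by (rule automorphism_exists[OF b, of "move i (f (lam i b)) b"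
          "\<lambda>k z. if k = i then f else (\<lambda>x\<in>X k. x)"])
      (use i b f fl lam_in id_Bij in auto)
  from someI_ex[OF this]
  show "shift i b f \<in> Aut" "shift i b f b = move i (f (lam i b)) b"
    "\<And>k z. k \<in> I \<Longrightarrow> z \<in> C \<Longrightarrow> loc k (shift i b f) z = (if k = i then f else (\<lambda>x\<in>X k. x))"
    unfolding shift_def by blast+
qed

lemma shift_move:
  assumes i: "i \<in> I" and b: "b \<in> C" and f: "f \<in> Bij (X i)" and z: "z \<in> C"
  shows "y \<in> X i \<Longrightarrow> shift i b f (move i y z) = move i (f y) (shift i b f z)"
    and "k \<in> I \<Longrightarrow> k \<noteq> i \<Longrightarrow> x \<in> X k \<Longrightarrow> shift i b f (move k x z) = move k x (shift i b f z)"
  using aut_move_loc[OF shift(1)[OF i b f] _ _ z] shift(3)[OF i b f _ z] i by simp_all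

lemma shift_panel:
  assumes i: "i \<in> I" and b: "b \<in> C" and f: "f \<in> Bij (X i)" and y: "y \<in> X i"
  shows "shift i b f (move i y b) = move i (f y) b"
proof -
  have "f y \<in> X i" "f (lam i b) \<in> X i" using BijGroup_inv_apply(4)[OF f] lam_in[OF i b] y by auto
  then show ?thesis using shift_move(1)[OF i b f b y] shift(2)[OF i b f] i b by simp
qed

lemma shift_U: "i \<in> I \<Longrightarrow> b \<in> C \<Longrightarrow> f \<in> F i \<Longrightarrow> shift i b f \<in> U"
  using shift[of i b f] F_Bij F_id by (auto simp: U_iff)

lemma shift_mult:
  assumes i: "i \<in> I" and b: "b \<in> C" and f: "f \<in> F i" and g: "g \<in> F i"
  shows "shift i b (f \<otimes>\<^bsub>BijGroup (X i)\<^esub> g) = shift i b f \<cdot> shift i b g"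
proof -
  have fB: "f \<in> Bij (X i)" and gB: "g \<in> Bij (X i)" using F_Bij i f g by auto
  have fg: "f \<otimes>\<^bsub>BijGroup (X i)\<^esub> g = compose (X i) f g" by (rule BijGroup_mult[OF fB gB])
  have fgB: "compose (X i) f g \<in> Bij (X i)" by (rule compose_Bij[OF fB gB])
  have gl: "g (lam i b) \<in> X i" using BijGroup_inv_apply(4)[OF gB] lam_in[OF i b] by simp
  note U = shift_U[OF i b f] shift_U[OF i b g]
  show ?thesis unfolding fg
  proof (rule aut_same_colours_eq[OF shift(1)[OF i b fgB] U_Aut[OF U_mul[OF U]] b])
    have "(shift i b f \<cdot> shift i b g) b = move i (f (g (lam i b))) b"
      using mul_apply[OF U b] shift(2)[OF i b gB] shift_panel[OF i b fB gl] by simp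
    then show "shift i b (compose (X i) f g) b = (shift i b f \<cdot> shift i b g) b"
      using shift(2)[OF i b fgB] lam_in[OF i b] by (simp add: compose_eq)
    show "loc k (shift i b (compose (X i) f g)) z = loc k (shift i b f \<cdot> shift i b g) z"
      if "k \<in> I" "z \<in> C" for k z
      unfolding loc_compose[OF U_Aut[OF U(1)] U_Aut[OF U(2)] that]
        shift(3)[OF i b fgB that] shift(3)[OF i b gB that]
        shift(3)[OF i b fB that(1) U_in[OF U(2) that(2)]]
      by (simp add: compose_def restrict_def fun_eq_iff)
  qed
qed

lemma shift_one: "i \<in> I \<Longrightarrow> b \<in> C \<Longrightarrow> shift i b (\<lambda>x\<in>X i. x) = (\<lambda>z\<in>C. z)"
proof (rule aut_same_colours_eq)
  assume i: "i \<in> I" and b: "b \<in> C"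
  note s = shift[OF i b id_Bij]
  show "shift i b (\<lambda>x\<in>X i. x) \<in> Aut" by (rule s)
  show "(\<lambda>z\<in>C. z) \<in> Aut" using subgroup.one_closed[OF subgroup_Aut] by simp
  show "b \<in> C" by (rule b)
  show "shift i b (\<lambda>x\<in>X i. x) b = (\<lambda>z\<in>C. z) b" using s(2) i b lam_in by simp
  show "loc k (shift i b (\<lambda>x\<in>X i. x)) z = loc k (\<lambda>z\<in>C. z) z" if "k \<in> I" "z \<in> C" for k z
    using s(3)[OF that] loc_id[OF that] by simp
qed

lemma shift_generated:
  assumes i: "i \<in> I" and b: "b \<in> C" and N: "subgroup N (BijGroup C)"
    and K: "K \<subseteq> F i" "shift i b ` K \<subseteq> N" "generate (perm_group (X i) (F i)) K = F i"
    and f: "f \<in> F i"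
  shows "shift i b f \<in> N"
proof -
  interpret B: group "BijGroup (X i)" by (rule group_BijGroup)
  interpret BC: group "BijGroup C" by (rule group_BijGroup)
  note Fi = subgroup_F[OF i]
  let ?L = "{f \<in> F i. shift i b f \<in> N}"
  have "subgroup ?L (BijGroup (X i))"
  proof (rule B.subgroupI)
    show "?L \<subseteq> carrier (BijGroup (X i))" using F_Bij[OF i] by auto
    have "(\<lambda>x\<in>X i. x) \<in> ?L"
      using F_id[OF i] shift_one[OF i b] subgroup.one_closed[OF N] by simp
    then show "?L \<noteq> {}" by blast
    show "f \<otimes>\<^bsub>BijGroup (X i)\<^esub> g \<in> ?L" if "f \<in> ?L" "g \<in> ?L" for f g
      using that shift_mult[OF i b] subgroup.m_closed[OF Fi] subgroup.m_closed[OF N] by simp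
    show "inv\<^bsub>BijGroup (X i)\<^esub> f \<in> ?L" if "f \<in> ?L" for f
    proof -
      let ?k = "inv\<^bsub>BijGroup (X i)\<^esub> f"
      have f: "f \<in> F i" "?k \<in> F i" using that subgroup.m_inv_closed[OF Fi] by auto
      have "?k \<otimes>\<^bsub>BijGroup (X i)\<^esub> f = \<one>\<^bsub>BijGroup (X i)\<^esub>"
        using F_Bij[OF i f(1)] by (intro B.l_inv) simp
      then have "shift i b ?k \<cdot> shift i b f = \<one>\<^bsub>BijGroup C\<^esub>"
        using shift_mult[OF i b f(2,1)] shift_one[OF i b] by simp
      then have "iv (shift i b f) = shift i b ?k"
        using f[THEN shift_U[OF i b]] by (intro BC.inv_equality) (auto intro: aut_Bij U_Aut)
      then show ?thesis using that f subgroup.m_inv_closed[OF N, of "shift i b f"] by simp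
    qed
  qed
  moreover have "K \<subseteq> ?L" using K by blast
  ultimately have "generate (BijGroup (X i)) K \<subseteq> ?L" by (rule B.generate_subgroup_incl[rotated])
  moreover have "generate (BijGroup (X i)) K = F i"
    using K(3) B.generate_consistent[OF K(1) Fi] by (simp add: perm_group_def)
  ultimately show ?thesis using f by blast
qed

text \<open>
The image of \<open>z\<close> depends only on how \<open>f\<close> acts on the \<open>i\<close>-colours that occur along a path from \<open>b\<close> to \<open>z\<close>.
\<close>

lemma shift_finitely_determined:
  assumes i: "i \<in> I" and b: "b \<in> C" and z: "z \<in> C"
  shows "\<exists>Y. finite Y \<and> Y \<subseteq> X i \<and>
    (\<forall>f\<in>Bij (X i). \<forall>g\<in>Bij (X i). (\<forall>y\<in>Y. f y = g y) \<longrightarrow> shift i b f z = shift i b g z)"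
  using b z
proof (induction rule: chamber_induct)
  case base
  show ?case
    using shift(2)[OF i b] lam_in[OF i b] by (intro exI[of _ "{lam i b}"]) simp
next
  case (move z k x)
  then obtain Y where Y: "finite Y" "Y \<subseteq> X i"
    "\<And>f g. \<lbrakk>f \<in> Bij (X i); g \<in> Bij (X i); \<forall>y\<in>Y. f y = g y\<rbrakk> \<Longrightarrow> shift i b f z = shift i b g z"
    by blast
  let ?Y = "if k = i then insert x Y else Y"
  have "shift i b f (move k x z) = shift i b g (move k x z)"
    if "f \<in> Bij (X i)" "g \<in> Bij (X i)" "\<forall>y\<in>?Y. f y = g y" for f g
  proof (cases "k = i")
    case True
    then show ?thesis
      using that move shift_move(1)[OF i b that(1)] shift_move(1)[OF i b that(2)] Y(3)[OF that(1,2)]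
      by simp
  next
    case False
    then show ?thesis
      using that move shift_move(2)[OF i b that(1)] shift_move(2)[OF i b that(2)] Y(3)[OF that(1,2)]
      by simp
  qed
  moreover have "finite ?Y" "?Y \<subseteq> X i" using Y(1,2) move by auto
  ultimately show ?case by blast
qed

lemma continuous_shift:
  assumes i: "i \<in> I" and b: "b \<in> C"
  shows "continuous_map (perm_topology (X i) (F i)) (perm_topology C U) (shift i b)"
  unfolding continuous_map_def topspace_perm_topology[OF subgroup_F[OF i]]
    topspace_perm_topology[OF subgroup_U]
proof (intro conjI allI impI)
  show "shift i b \<in> F i \<rightarrow> U" using shift_U[OF i b] by blast
  fix V assume V: "openin (perm_topology C U) V"
  have "\<exists>Y. finite Y \<and> Y \<subseteq> X i \<and> {g \<in> F i. \<forall>y\<in>Y. g y = f y} \<subseteq> {f \<in> F i. shift i b f \<in> V}"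
    if f: "f \<in> F i" "shift i b f \<in> V" for f
  proof -
    from V[unfolded openin_perm_topology_iff[OF subgroup_U], THEN conjunct2, rule_format, OF f(2)]
    obtain A where A: "finite A" "A \<subseteq> C" "{h \<in> U. \<forall>z\<in>A. h z = shift i b f z} \<subseteq> V"
      by (elim exE conjE)
    have "\<forall>z\<in>A. \<exists>Y. finite Y \<and> Y \<subseteq> X i \<and>
        (\<forall>f\<in>Bij (X i). \<forall>g\<in>Bij (X i). (\<forall>y\<in>Y. f y = g y) \<longrightarrow> shift i b f z = shift i b g z)"
      using A(2) by (intro ballI shift_finitely_determined[OF i b]) (rule subsetD)
    from bchoice[OF this] obtain Y where Y: "\<forall>z\<in>A. finite (Y z) \<and> Y z \<subseteq> X i \<and>
        (\<forall>f\<in>Bij (X i). \<forall>g\<in>Bij (X i). (\<forall>y\<in>Y z. f y = g y) \<longrightarrow> shift i b f z = shift i b g z)"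
      by (elim exE)
    have "shift i b g \<in> V" if g: "g \<in> F i" "\<forall>y\<in>\<Union>(Y ` A). g y = f y" for g
    proof -
      have "shift i b g z = shift i b f z" if "z \<in> A" for z
        using Y that g F_Bij[OF i g(1)] F_Bij[OF i f(1)] by blast
      then show ?thesis using A(3) shift_U[OF i b g(1)] by blast
    qed
    then show ?thesis using Y A(1) by (intro exI[of _ "\<Union>(Y ` A)"]) auto
  qed
  then show "openin (perm_topology (X i) (F i)) {f \<in> F i. shift i b f \<in> V}"
    unfolding openin_perm_topology_iff[OF subgroup_F[OF i]] by blast
qed

end

section \<open>Compact generation\<close>

context coloured_universal_group
begin

text \<open>
The orbit of a chamber is determined by the \<open>F i\<close>-orbits of its colours, and there are finitely many
combinations of these.
\<close>

lemma chamber_representatives: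
  assumes "finite I" and "\<And>i. i \<in> I \<Longrightarrow> finite (orbits (perm_group (X i) (F i)) (X i) (\<lambda>g. g))"
  obtains B where "finite B" "B \<subseteq> C" "\<forall>z\<in>C. \<exists>b\<in>B. \<exists>g\<in>U. g b = z"
proof -
  let ?o = "\<lambda>i. orbit (perm_group (X i) (F i)) (\<lambda>g. g)"
  let ?t = "\<lambda>z. \<lambda>i\<in>I. ?o i (lam i z)"
  have "?t ` C \<subseteq> (\<Pi>\<^sub>E i\<in>I. orbits (perm_group (X i) (F i)) (X i) (\<lambda>g. g))"
    using lam_in by (auto simp: orbits_def)
  moreover have "finite (\<Pi>\<^sub>E i\<in>I. orbits (perm_group (X i) (F i)) (X i) (\<lambda>g. g))"
    using assms by (intro finite_PiE)
  ultimately have "finite (?t ` C)" by (rule finite_subset)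
  from finite_subset_image[OF this subset_refl]
  obtain B where B: "B \<subseteq> C" "finite B" "?t ` C = ?t ` B" by (elim exE conjE)
  have "\<forall>z\<in>C. \<exists>b\<in>B. \<exists>g\<in>U. g b = z"
  proof
    fix z assume z: "z \<in> C"
    obtain b where b: "b \<in> B" "?t z = ?t b" using B(3) z by blast
    have f: "\<exists>f\<in>F i. f (lam i b) = lam i z" if i: "i \<in> I" for i
    proof -
      have "?o i (lam i z) = ?o i (lam i b)" using fun_cong[OF b(2), of i] i by simp
      moreover have "lam i z \<in> ?o i (lam i z)"
        using F_id[OF i] lam_in[OF i z] unfolding orbit_def perm_group_def
        by (auto intro!: exI[of _ "\<lambda>x\<in>X i. x"])
      ultimately show ?thesis by (auto simp: orbit_def perm_group_def)
    qed
    have "\<exists>g\<in>U. g b = z"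
      by (rule transitive_on_orbit_types[OF subsetD[OF B(1) b(1)] z f])
    then show "\<exists>b\<in>B. \<exists>g\<in>U. g b = z" using b(1) by blast
  qed
  then show ?thesis by (rule that[OF B(2,1)])
qed

text \<open>
The set of chambers \<open>n b\<close> is closed under moves. Applying \<open>n\<close> reduces this to a move from \<open>b\<close>; there
a shift replaces the target colour by the representative \<open>r\<close> of its \<open>F i\<close>-orbit, and
for these finitely many targets an element \<open>s\<close> of \<open>N\<close> leads back to \<open>B\<close>.
\<close>

lemma subgroup_covers_chambers:
  assumes N: "subgroup N (BijGroup C)" "N \<subseteq> U" and B: "B \<subseteq> C" "B \<noteq> {}"
    and shifts: "\<And>i b f. \<lbrakk>i \<in> I; b \<in> B; f \<in> F i\<rbrakk> \<Longrightarrow> shift i b f \<in> N"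
    and Y: "\<And>i y. \<lbrakk>i \<in> I; y \<in> X i\<rbrakk> \<Longrightarrow> \<exists>r\<in>Y i. \<exists>f\<in>F i. f r = y"
    and YX: "\<And>i. i \<in> I \<Longrightarrow> Y i \<subseteq> X i"
    and steps: "\<And>i b r. \<lbrakk>i \<in> I; b \<in> B; r \<in> Y i\<rbrakk> \<Longrightarrow> \<exists>s\<in>N. \<exists>b'\<in>B. s b' = move i r b"
    and z: "z \<in> C"
  shows "\<exists>n\<in>N. \<exists>b\<in>B. n b = z"
proof -
  obtain b0 where b0: "b0 \<in> B" "b0 \<in> C" using B by blast
  from b0(2) z show ?thesis
  proof (induction rule: chamber_induct)
    case base
    have "(\<lambda>z\<in>C. z) \<in> N" using subgroup.one_closed[OF N(1)] by simp
    then show ?case using b0 by (metis restrict_apply')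
  next
    case (move z i y)
    then obtain n b where n: "n \<in> N" "b \<in> B" "n b = z" by blast
    have nU: "n \<in> U" and bC: "b \<in> C" using n N B by auto
    have "y \<in> loc i n b ` X i"
      using loc_Bij[OF U_Aut[OF nU] move(2) bC] move(3) by (simp add: Bij_def bij_betw_def)
    then obtain y' where y': "y' \<in> X i" "y = loc i n b y'" by blast
    obtain r f where r: "r \<in> Y i" "f \<in> F i" "f r = y'" using Y[OF move(2) y'(1)] by blast
    obtain s b' where s: "s \<in> N" "b' \<in> B" "s b' = move i r b" using steps[OF move(2) n(2) r(1)] by blast
    have sU: "s \<in> U" and b': "b' \<in> C" and rX: "r \<in> X i" using s N B r YX[OF move(2)] by auto
    let ?k = "shift i b f"
    have k: "?k \<in> N" "?k \<in> U" using shifts[OF move(2) n(2) r(2)] N(2) by auto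
    have "(n \<cdot> (?k \<cdot> s)) b' = n (?k (move i r b))"
      using mul_apply[OF nU U_mul[OF k(2) sU] b'] mul_apply[OF k(2) sU b'] s(3) by simp
    also have "\<dots> = n (move i y' b)"
      using shift_panel[OF move(2) bC F_Bij[OF move(2) r(2)] rX] r(3) by simp
    also have "\<dots> = move i y z"
      using aut_move_loc[OF U_Aut[OF nU] move(2) y'(1) bC] y'(2) n(3) by simp
    finally show ?case
      using subgroup.m_closed[OF N(1) n(1) subgroup.m_closed[OF N(1) k(1) s(1)]] s(2) by blast
  qed
qed

definition isolated :: "'i set" where
  "isolated = {i \<in> I. \<forall>j\<in>I. j \<noteq> i \<longrightarrow> commuting I M i j}"

text \<open>
For an isolated type the point stabilisers of \<open>F i\<close> may have infinite orbits, so fixing \<open>c\<close> alone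
would not give finite orbits; the whole panel is fixed instead.
\<close>

definition panel_fixer :: "'c \<Rightarrow> ('c \<Rightarrow> 'c) set" where
  "panel_fixer c = {h \<in> U. h c = c \<and> (\<forall>i\<in>isolated. \<forall>y\<in>X i. h (move i y c) = move i y c)}"

text \<open>
One panel at a time: if \<open>f\<close> is the local action of an element fixing \<open>c\<close>, then the shift by
the inverse of \<open>f\<close> fixes \<open>c\<close> and cancels it, and it leaves the panels of all other types at \<open>c\<close>
pointwise fixed.
\<close>

lemma fix_isolated_panels:
  assumes N: "subgroup N (BijGroup C)" "N \<subseteq> U" and c: "c \<in> C" and "finite I"
    and shifts: "\<And>i f. \<lbrakk>i \<in> I; f \<in> F i\<rbrakk> \<Longrightarrow> shift i c f \<in> N"
    and h: "h \<in> U" "h c = c"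
  shows "\<exists>n\<in>N. n \<cdot> h \<in> panel_fixer c"
proof -
  have "\<exists>n\<in>N. (n \<cdot> h) c = c \<and> (\<forall>i\<in>J. \<forall>y\<in>X i. (n \<cdot> h) (move i y c) = move i y c)"
    if "finite J" "J \<subseteq> I" for J
    using that
  proof (induction rule: finite_induct)
    case empty
    have "\<one>\<^bsub>BijGroup C\<^esub> \<cdot> h = h"
      using group.is_monoid[OF group_BijGroup] aut_Bij[OF U_Aut[OF h(1)]] by (intro monoid.l_one) simp_all
    then show ?case using subgroup.one_closed[OF N(1)] h(2) by (metis empty_iff)
  next
    case (insert i J)
    from insert.prems have "J \<subseteq> I" by simp
    from insert.IH[OF this] obtain n where n: "n \<in> N" "(n \<cdot> h) c = c"
        "\<forall>k\<in>J. \<forall>y\<in>X k. (n \<cdot> h) (move k y c) = move k y c" by (elim bexE conjE)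
    have i: "i \<in> I" using insert by simp
    let ?g = "n \<cdot> h" and ?f = "loc i (n \<cdot> h) c"
    have g: "?g \<in> U" using n(1) N(2) U_mul h(1) by blast
    have f: "?f \<in> F i" using g i c by (simp add: U_iff)
    let ?k = "inv\<^bsub>BijGroup (X i)\<^esub> ?f"
    have k: "?k \<in> F i" by (rule subgroup.m_inv_closed[OF subgroup_F[OF i] f])
    note fB = F_Bij[OF i f] and kB = F_Bij[OF i k]
    have kf: "?k (?f y) = y" "?f y \<in> X i" if "y \<in> X i" for y
      using BijGroup_inv_apply[OF fB that] by simp_all
    have g_move: "?g (move l y c) = move l (loc l ?g c y) c" if "l \<in> I" "y \<in> X l" for l y
      using aut_move_loc[OF U_Aut[OF g] that c] n(2) by simp
    have f_fix: "?f (lam i c) = lam i c" using n(2) lam_in[OF i c] i c by (simp add: loc_def)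
    let ?s = "shift i c ?k"
    have s: "?s \<in> N" "?s \<in> U" using shifts[OF i k] N(2) by auto
    have sc: "?s c = c"
      using shift(2)[OF i c kB] kf(1)[OF lam_in[OF i c]] f_fix i c by simp
    have sg: "(?s \<cdot> ?g) z = ?s (?g z)" if "z \<in> C" for z using mul_apply[OF s(2) g that] .
    have "(?s \<cdot> ?g) (move l y c) = move l y c" if l: "l \<in> insert i J" and y: "y \<in> X l" for l y
    proof (cases "l = i")
      case True
      then show ?thesis
        using sg[of "move i y c"] g_move[of i y] shift_panel[OF i c kB, of "?f y"] kf[of y] y i c by simp
    next
      case False
      then have "l \<in> I" "l \<in> J" using l insert by auto
      then show ?thesis
        using sg[of "move l y c"] bspec[OF bspec[OF n(3)], of l y] shift_move(2)[OF i c kB c, of l y] sc y c False by simp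
    qed
    moreover have "(?s \<cdot> ?g) c = c" using sg[OF c] n(2) sc by simp
    moreover have "?s \<cdot> ?g = (?s \<cdot> n) \<cdot> h"
      using s n(1) N(2) h(1) aut_Bij U_Aut
      by (intro monoid.m_assoc[OF group.is_monoid[OF group_BijGroup], symmetric]) auto
    ultimately show ?case
      using subgroup.m_closed[OF N(1) s(1) n(1)] by (intro bexI[of _ "?s \<cdot> n"]) simp_all
  qed
  from this[of isolated] obtain n where "n \<in> N" "(n \<cdot> h) c = c"
    "\<forall>i\<in>isolated. \<forall>y\<in>X i. (n \<cdot> h) (move i y c) = move i y c"
    using \<open>finite I\<close> by (auto simp: isolated_def)
  moreover have "n \<cdot> h \<in> U" using \<open>n \<in> N\<close> N(2) U_mul h(1) by blast
  ultimately show ?thesis by (auto simp: panel_fixer_def)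
qed

text \<open>
All panels of an isolated type are parallel to the one at \<open>c\<close>, so the local action is the same, namely
trivial, at all of them.
\<close>

lemma panel_fixer_isolated_move:
  assumes c: "c \<in> C" and h: "h \<in> panel_fixer c" and i: "i \<in> isolated" and z: "z \<in> C" and y: "y \<in> X i"
  shows "h (move i y z) = move i y (h z)"
proof -
  have iI: "i \<in> I" and hU: "h \<in> U" and hA: "h \<in> Aut"
    using i h U_Aut by (auto simp: isolated_def panel_fixer_def)
  have "loc i h z = (\<lambda>x\<in>X i. x)"
    using c z
  proof (induction rule: chamber_induct)
    case base
    show ?case using h i iI c by (auto simp: loc_def panel_fixer_def)
  next
    case (move z l x)
    show ?case
    proof (cases "l = i")
      case True
      then have "loc i h (move l x z) = loc i h z" using move iI by (auto simp: loc_def)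
      then show ?thesis using move by simp
    next
      case False
      then have il: "commuting I M i l" using i move by (auto simp: isolated_def)
      have "lam i (h (move i y (move l x z))) = y" if "y \<in> X i" for y
      proof -
        have "lam i (h (move i y (move l x z))) = lam i (h (move l x (move i y z)))"
          using move_commute[OF il that move(3,1)] by simp
        also have "\<dots> = lam i (h (move i y z))"
          using aut_lam_other[OF hA iI move(2) _ move(3), of "move i y z"] False that iI move by simp
        also have "\<dots> = loc i h z y" using that by (simp add: loc_def)
        finally show ?thesis using move(4) that by simp
      qed
      then show ?thesis by (auto simp: loc_def)
    qed
  qed
  then show ?thesis using aut_move_loc[OF hA iI y z] y by simp
qed

text \<open>
Along a path from \<open>c\<close> the orbits stay finite. If \<open>i\<close> is isolated, the orbit of \<open>move i y z\<close> is
the image of that of \<open>z\<close>. Otherwise it has, over each point of the orbit of \<open>z\<close>, at most as many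
points as an orbit of a point stabiliser in \<open>F i\<close>.
\<close>

lemma panel_fixer_finite_orbits:
  assumes c: "c \<in> C" and z: "z \<in> C"
    and fin: "\<And>i x y. \<lbrakk>i \<in> I; i \<notin> isolated; x \<in> X i; y \<in> X i\<rbrakk> \<Longrightarrow> finite {f y | f. f \<in> F i \<and> f x = x}"
  shows "finite ((\<lambda>h. h z) ` panel_fixer c)"
  using c z
proof (induction rule: chamber_induct)
  case base
  have "(\<lambda>h. h c) ` panel_fixer c \<subseteq> {c}" by (auto simp: panel_fixer_def)
  then show ?case by (rule finite_subset) simp
next
  case (move z i y)
  let ?V = "panel_fixer c"
  show ?case
  proof (cases "i \<in> isolated")
    case True
    have "(\<lambda>h. h (move i y z)) ` ?V \<subseteq> move i y ` ((\<lambda>h. h z) ` ?V)"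
      using panel_fixer_isolated_move[OF c _ True move(1,3)] by auto
    then show ?thesis by (rule finite_subset) (use move in simp)
  next
    case False
    let ?O = "{f y | f. f \<in> F i \<and> f (lam i z) = lam i z}"
    have O: "finite ?O" using fin[OF move(2) False lam_in[OF move(2,1)] move(3)] .
    have "finite ((\<lambda>h. h (move i y z)) ` {h \<in> ?V. h z = w})" if w: "w \<in> (\<lambda>h. h z) ` ?V" for w
    proof -
      obtain h0 where h0: "h0 \<in> ?V" "h0 z = w" using w by blast
      have "h (move i y z) \<in> (\<lambda>v. h0 (move i v z)) ` ?O" if h: "h \<in> ?V" "h z = w" for h
      proof -
        have U: "h0 \<in> U" "h \<in> U" using h h0 by (auto simp: panel_fixer_def)
        let ?k = "iv h0 \<cdot> h"
        have k: "?k \<in> U" using U U_mul U_iv by blast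
        have "?k z = z" using mul_apply[OF U_iv[OF U(1)] U(2) move(1)] iv_apply[OF U(1) move(1) h0(2)] h(2) by simp
        then have "loc i ?k z \<in> F i" "loc i ?k z (lam i z) = lam i z"
          using k move by (auto simp: U_iff) (simp add: loc_def lam_in)
        then have "loc i ?k z y \<in> ?O" by blast
        moreover have "h (move i y z) = h0 (move i (loc i ?k z y) z)"
        proof -
          have "h (move i y z) = (h0 \<cdot> ?k) (move i y z)" using iv_cancel(1)[OF U] by simp
          also have "\<dots> = h0 (?k (move i y z))" using mul_apply[OF U(1) k] move by simp
          also have "\<dots> = h0 (move i (loc i ?k z y) z)"
            using aut_move_loc[OF U_Aut[OF k] move(2,3,1)] \<open>?k z = z\<close> by simp
          finally show ?thesis .
        qed
        ultimately show ?thesis by blast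
      qed
      then have "(\<lambda>h. h (move i y z)) ` {h \<in> ?V. h z = w} \<subseteq> (\<lambda>v. h0 (move i v z)) ` ?O" by blast
      then show ?thesis using finite_imageI[OF O] by (rule finite_subset)
    qed
    then have "finite (\<Union>w\<in>(\<lambda>h. h z) ` ?V. (\<lambda>h. h (move i y z)) ` {h \<in> ?V. h z = w})"
      using move(4) by (intro finite_UN_I)
    moreover have "(\<lambda>h. h (move i y z)) ` ?V \<subseteq>
        (\<Union>w\<in>(\<lambda>h. h z) ` ?V. (\<lambda>h. h (move i y z)) ` {h \<in> ?V. h z = w})" by blast
    ultimately show ?thesis by (rule finite_subset[rotated])
  qed
qed

text \<open>
Two elements that agree on \<open>A\<close> differ by an element of the pointwise stabiliser of \<open>A\<close>, and finite
orbits leave only finitely many possibilities for the restriction to \<open>A\<close>.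
\<close>

lemma panel_fixer_finite_index:
  assumes c: "c \<in> C" and A: "finite A" "A \<subseteq> C"
    and orbits: "\<And>z. z \<in> C \<Longrightarrow> finite ((\<lambda>h. h z) ` panel_fixer c)"
  obtains E where "finite E" "E \<subseteq> U"
    "\<forall>h\<in>panel_fixer c. \<exists>v\<in>E. iv v \<cdot> h \<in> pointwise_stabilizer U A"
proof -
  let ?V = "panel_fixer c"
  have VU: "?V \<subseteq> U" by (auto simp: panel_fixer_def)
  have "(\<lambda>h. restrict h A) ` ?V \<subseteq> (\<Pi>\<^sub>E z\<in>A. (\<lambda>h. h z) ` ?V)" by auto
  moreover have "finite (\<Pi>\<^sub>E z\<in>A. (\<lambda>h. h z) ` ?V)"
    using A orbits by (intro finite_PiE) auto
  ultimately have "finite ((\<lambda>h. restrict h A) ` ?V)" by (rule finite_subset)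
  from finite_subset_image[OF this subset_refl]
  obtain E where E: "E \<subseteq> ?V" "finite E" "(\<lambda>h. restrict h A) ` ?V = (\<lambda>h. restrict h A) ` E"
    by (elim exE conjE)
  have "\<forall>h\<in>?V. \<exists>v\<in>E. iv v \<cdot> h \<in> pointwise_stabilizer U A"
  proof
    fix h assume h: "h \<in> ?V"
    obtain v where v: "v \<in> E" "restrict h A = restrict v A" using E(3) h by blast
    have U: "v \<in> U" "h \<in> U" using v E VU h by auto
    have "(iv v \<cdot> h) z = z" if "z \<in> A" for z
    proof -
      have "h z = v z" using fun_cong[OF v(2), of z] that by simp
      moreover have zC: "z \<in> C" using that A by blast
      ultimately show ?thesis
        using mul_apply[OF U_iv[OF U(1)] U(2) zC] iv_apply[OF U(1) zC] by simp
    qed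
    then have "iv v \<cdot> h \<in> pointwise_stabilizer U A"
      using U_mul[OF U_iv[OF U(1)] U(2)] by (simp add: pointwise_stabilizer_def)
    then show "\<exists>v\<in>E. iv v \<cdot> h \<in> pointwise_stabilizer U A" using v(1) by blast
  qed
  then show ?thesis by (rule that[OF E(2) subset_trans[OF E(1) VU]])
qed

theorem universal_group_compactly_generated:
  assumes I: "finite I" and lc: "locally_compact_space (perm_topology C U)"
    and cg: "\<And>i. i \<in> I \<Longrightarrow> compactly_generated (perm_group (X i) (F i)) (perm_topology (X i) (F i))"
    and orb: "\<And>i. i \<in> I \<Longrightarrow> finite (orbits (perm_group (X i) (F i)) (X i) (\<lambda>g. g))"
  shows "compactly_generated (perm_group C U) (perm_topology C U)"
proof -
  let ?T = "perm_topology C U"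
  obtain A where A: "finite A" "A \<subseteq> C" "compactin ?T (pointwise_stabilizer U A)"
    using locally_compact_perm_group[OF subgroup_U lc] .
  obtain c where c: "c \<in> C" using building by (auto simp: building_def)
  have "finite {g z | g. g \<in> U \<and> (\<forall>b\<in>A. g b = b)}" if "z \<in> C" for z
  proof -
    have "{g z | g. g \<in> U \<and> (\<forall>b\<in>A. g b = b)} = (\<lambda>g. g z) ` pointwise_stabilizer U A"
      by (auto simp: pointwise_stabilizer_def)
    then show ?thesis using compact_orbit_finite[OF subgroup_U A(3) that] by simp
  qed
  then have "finite {f y | f. f \<in> F i \<and> f x = x}"
    if "i \<in> I" "i \<notin> isolated" "x \<in> X i" "y \<in> X i" for i x y
    using that point_stabilizer_finite_orbits[of i _ x y A] A by (auto simp: isolated_def)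
  note finite_orbits = panel_fixer_finite_orbits[OF c _ this]
  \<comment> \<open>Representatives for the cosets of the compact stabiliser that meet \<open>panel_fixer c\<close>.\<close>
  obtain E where E: "finite E" "E \<subseteq> U"
    "\<forall>h\<in>panel_fixer c. \<exists>v\<in>E. iv v \<cdot> h \<in> pointwise_stabilizer U A"
    by (rule panel_fixer_finite_index[OF c A(1,2) finite_orbits])
  obtain B0 where B0: "finite B0" "B0 \<subseteq> C" "\<forall>z\<in>C. \<exists>b\<in>B0. \<exists>g\<in>U. g b = z"
    by (rule chamber_representatives[OF I orb])
  \<comment> \<open>The chamber \<open>c\<close> is added because shifts based at \<open>c\<close> are needed for \<open>fix_isolated_panels\<close>.\<close>
  define B where "B = insert c B0"
  have B: "finite B" "B \<subseteq> C" "c \<in> B" using B0 c by (auto simp: B_def)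
  have "\<forall>i\<in>I. \<exists>Y. finite Y \<and> Y \<subseteq> X i \<and> (\<forall>y\<in>X i. \<exists>r\<in>Y. \<exists>f\<in>F i. f r = y)"
  proof
    fix i assume i: "i \<in> I"
    show "\<exists>Y. finite Y \<and> Y \<subseteq> X i \<and> (\<forall>y\<in>X i. \<exists>r\<in>Y. \<exists>f\<in>F i. f r = y)"
      by (rule finite_orbit_representatives[OF subgroup_F[OF i] orb[OF i]]) blast
  qed
  from bchoice[OF this] obtain Y where
    Y: "\<forall>i\<in>I. finite (Y i) \<and> Y i \<subseteq> X i \<and> (\<forall>y\<in>X i. \<exists>r\<in>Y i. \<exists>f\<in>F i. f r = y)"
    by (elim exE)
  have "\<forall>i\<in>I. \<exists>K. K \<subseteq> F i \<and> compactin (perm_topology (X i) (F i)) K \<and>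
      generate (perm_group (X i) (F i)) K = F i"
    using cg by (simp add: compactly_generated_def perm_group_def)
  from bchoice[OF this] obtain K where
    K: "\<forall>i\<in>I. K i \<subseteq> F i \<and> compactin (perm_topology (X i) (F i)) (K i) \<and>
      generate (perm_group (X i) (F i)) (K i) = F i"
    by (elim exE)
  let ?D = "Sigma (B \<times> I) (\<lambda>(b, i). Y i)"
  have "finite ?D" using B I Y by auto
  moreover have "\<exists>s\<in>U. \<exists>b'\<in>B. s b' = move (snd (fst d)) (snd d) (fst (fst d))" if dD: "d \<in> ?D" for d
  proof -
    obtain b i r where d: "d = ((b, i), r)" "b \<in> B" "i \<in> I" "r \<in> Y i" using dD by auto
    then have "b \<in> C" "r \<in> X i" using B(2) Y by auto
    then have "move i r b \<in> C" using d(3) by simp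
    from bspec[OF B0(3) this] show ?thesis using d(1) by (auto simp: B_def)
  qed
  \<comment> \<open>These elements bring the neighbours of \<open>B\<close> with representative colours back to \<open>B\<close>.\<close>
  ultimately obtain S where S: "finite S" "S \<subseteq> U"
      "\<forall>d\<in>?D. \<exists>s\<in>S. \<exists>b'\<in>B. s b' = move (snd (fst d)) (snd d) (fst (fst d))"
    by (rule finite_witnesses)
  \<comment> \<open>These connect \<open>c\<close> to the chambers of \<open>B\<close> in its own orbit.\<close>
  obtain T where T: "finite T" "T \<subseteq> U" "\<forall>b\<in>{b \<in> B. \<exists>t\<in>U. t c = b}. \<exists>t\<in>T. t c = b"
    by (rule finite_witnesses[of "{b \<in> B. \<exists>t\<in>U. t c = b}" U "\<lambda>b t. t c = b"]) (use B(1) in auto)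
  let ?\<Phi> = "\<Union>(b, i)\<in>B \<times> I. shift i b ` K i"
  let ?K = "pointwise_stabilizer U A \<union> E \<union> S \<union> T \<union> ?\<Phi>"
  have shift_K: "shift i b ` K i \<subseteq> U" "compactin ?T (shift i b ` K i)" if "i \<in> I" "b \<in> B" for i b
  proof -
    have bC: "b \<in> C" using that B(2) by blast
    have "K i \<subseteq> F i" "compactin (perm_topology (X i) (F i)) (K i)" using K that by auto
    then show "shift i b ` K i \<subseteq> U" "compactin ?T (shift i b ` K i)"
      using shift_U[OF that(1) bC] image_compactin[OF _ continuous_shift[OF that(1) bC]] by auto
  qed
  then have "?\<Phi> \<subseteq> U" by auto
  moreover have "pointwise_stabilizer U A \<subseteq> U" by (auto simp: pointwise_stabilizer_def)
  ultimately have KU: "?K \<subseteq> U" using E(2) S(2) T(2) by simp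
  have "compactin ?T ?\<Phi>" using B(1) I shift_K(2) by (intro compactin_Union) auto
  moreover have "compactin ?T E" "compactin ?T S" "compactin ?T T"
    using E S T by (auto intro!: finite_imp_compactin simp: topspace_perm_topology[OF subgroup_U])
  ultimately have compact: "compactin ?T ?K" using A(3) by (intro compactin_Un)
  define N where "N = generate (perm_group C U) ?K"
  note N = perm_group_generate[OF subgroup_U KU, folded N_def]
  have shifts: "shift i b f \<in> N" if "i \<in> I" "b \<in> B" "f \<in> F i" for i b f
  proof (rule shift_generated[OF that(1) subsetD[OF B(2) that(2)] N(1) _ _ _ that(3)])
    show "shift i b ` K i \<subseteq> N" using N(3) that by blast
  qed (use K that in auto)
  have cover: "\<exists>n\<in>N. \<exists>b\<in>B. n b = z" if "z \<in> C" for z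
  proof (rule subgroup_covers_chambers[OF N(1,2) B(2) _ _ _ _ _ that, of Y])
    show "\<exists>s\<in>N. \<exists>b'\<in>B. s b' = move i r b" if "i \<in> I" "b \<in> B" "r \<in> Y i" for i b r
      using bspec[OF S(3), of "((b, i), r)"] that N(3) by auto
  qed (use B Y shifts in auto)
  have "g \<in> N" if g: "g \<in> U" for g
  proof -
    \<comment> \<open>Multiplication by elements of \<open>N\<close> first moves \<open>g c\<close> into \<open>B\<close>, then back to \<open>c\<close>,
      and then leads into \<open>panel_fixer c\<close> and into the stabiliser of \<open>A\<close>.\<close>
    obtain n b where n: "n \<in> N" "b \<in> B" "n b = g c" using cover[OF U_in[OF g c]] by blast
    have nU: "n \<in> U" "iv n \<in> U" using n N(2) U_iv by auto
    have bC: "b \<in> C" using n(2) B(2) by blast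
    let ?g = "iv n \<cdot> g"
    have gU: "?g \<in> U" using U_mul nU g by blast
    have "?g c = b" using mul_apply[OF nU(2) g c] iv_apply[OF nU(1) bC n(3)] by simp
    then have "b \<in> {b \<in> B. \<exists>t\<in>U. t c = b}" using gU n(2) by blast
    then obtain t where t: "t \<in> T" "t c = b" using T(3) by blast
    have tN: "t \<in> N" "t \<in> U" "iv t \<in> U" using t N T U_iv by auto
    let ?h = "iv t \<cdot> ?g"
    have hU: "?h \<in> U" using U_mul tN gU by blast
    have "?h c = c"
      using mul_apply[OF tN(3) gU c] iv_apply[OF tN(2) c t(2)] \<open>?g c = b\<close> by simp
    then obtain m where m: "m \<in> N" "m \<cdot> ?h \<in> panel_fixer c"
      using fix_isolated_panels[OF N(1,2) c I _ hU] shifts B(3) by blast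
    then obtain v where v: "v \<in> E" "iv v \<cdot> (m \<cdot> ?h) \<in> pointwise_stabilizer U A" using E(3) by blast
    have vN: "v \<in> N" "v \<in> U" and mU: "m \<in> U" using v(1) E(2) N m by auto
    have mhU: "m \<cdot> ?h \<in> U" using U_mul mU hU by blast
    note closed = subgroup.m_closed[OF N(1)] and inv_closed = subgroup.m_inv_closed[OF N(1)]
    have "iv v \<cdot> (m \<cdot> ?h) \<in> N" using v(2) N(3) by blast
    then have "m \<cdot> ?h \<in> N" using closed[OF vN(1)] iv_cancel(1)[OF vN(2) mhU] by metis
    then have "?h \<in> N" using closed[OF inv_closed[OF m(1)]] iv_cancel(2)[OF mU hU] by metis
    then have "?g \<in> N" using closed[OF tN(1)] iv_cancel(1)[OF tN(2) gU] by metis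
    then show "g \<in> N" using closed[OF n(1)] iv_cancel(1)[OF nU(1) g] by metis
  qed
  then have generated: "generate (perm_group C U) ?K = U" using N(2) unfolding N_def by blast
  have carrier: "carrier (perm_group C U) = U" by (simp add: perm_group_def)
  show ?thesis
    unfolding compactly_generated_def carrier by (intro exI[of _ ?K] conjI KU compact generated)
qed

end

theorem theorem4p8:
  fixes I :: "'i set" and M :: "'i \<Rightarrow> 'i \<Rightarrow> enat"
    and C :: "'c set" and R :: "'i \<Rightarrow> ('c \<times> 'c) set" and \<delta> :: "'c \<Rightarrow> 'c \<Rightarrow> 'i list set"
    and X :: "'i \<Rightarrow> 'x set" and F :: "'i \<Rightarrow> ('x \<Rightarrow> 'x) set" and lam :: "'i \<Rightarrow> 'c \<Rightarrow> 'x"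
  assumes "finite I" and "right_angled_coxeter_matrix I M"
    and "\<And>i. i \<in> I \<Longrightarrow> \<exists>x\<in>X i. \<exists>y\<in>X i. x \<noteq> y"
    and "\<And>i. i \<in> I \<Longrightarrow> subgroup (F i) (BijGroup (X i))"
    and "building I M C R \<delta>" and "semiregular I C R X"
    and "legal_colouring I C R X lam"
    and "closedin (perm_topology C (building_aut I C R)) (universal_group I C R X lam F)"
    and "locally_compact_space (perm_topology C (universal_group I C R X lam F))"
    and "\<And>i. i \<in> I \<Longrightarrow>
           compactly_generated (perm_group (X i) (F i)) (perm_topology (X i) (F i))"
    and "\<And>i. i \<in> I \<Longrightarrow> finite (orbits (perm_group (X i) (F i)) (X i) (\<lambda>g. g))"
  shows "compactly_generated (perm_group C (universal_group I C R X lam F))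
           (perm_topology C (universal_group I C R X lam F))"
proof -
  interpret coloured_universal_group I M C R \<delta> X lam F
    by (intro coloured_universal_group.intro coloured_building.intro right_angled.intro
        coloured_building_axioms.intro coloured_universal_group_axioms.intro assms)
  show ?thesis by (rule universal_group_compactly_generated) (fact assms)+
qed

end
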